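(* Let $n\geq 14$ and let $G\in\mathfrak{C}_{n,3}$. Then $W(G)\leq W(L_{n,n-3})$, and equality holds if and only if $G\cong L_{n,n-3}$.
   Context: All graphs are simple, finite, connected and undirected. A cut vertex of a graph is a vertex whose removal makes the graph disconnected. $\mathfrak{C}_{n,k}$ denotes the set of all connected graphs on $n$ vertices with exactly $k$ cut vertices. The Wiener index $W(G)$ is the sum of the distances $d(u,v)$ (number of edges of a shortest path) over all unordered pairs of vertices $\{u,v\}$ of $G$. $P_m$ and $C_m$ are the path and the cycle on $m$ vertices. For $3\leq g\leq n-1$, $L_{n,g}$ is the graph on $n$ vertices obtained by identifying a pendant (degree one) vertex of the path $P_{n-g+1}$ with a vertex of the cycle $C_g$. The symbol $\cong$ denotes graph isomorphism. *)

theory Defs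
  imports "Graph_Theory.Graph_Theory"
begin

text \<open>
  A finite simple undirected graph is a \<^locale>\<open>pair_graph\<close>: a finite vertex set with a symmetric
  irreflexive arc set, every undirected edge being represented by its two opposite arcs.
\<close>

definition graph_dist :: "'a pair_pre_digraph \<Rightarrow> 'a \<Rightarrow> 'a \<Rightarrow> nat" where
  "graph_dist G u v = (LEAST k. \<exists>p. pre_digraph.apath (with_proj G) u p v \<and> length p = k)"

text \<open>
  The sum ranges over unordered pairs, i.e. two-element vertex sets; the description is well defined
  because distances in a \<^locale>\<open>pair_graph\<close> are symmetric (lemma \<open>graph_dist_sym\<close> below).
\<close>

definition wiener_index :: "'a pair_pre_digraph \<Rightarrow> nat" where
  "wiener_index G =
     (\<Sum>e | e \<subseteq> pverts G \<and> card e = 2. THE d. \<exists>u v. e = {u, v} \<and> d = graph_dist G u v)"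

text \<open>
  In the library the empty graph is not connected. The last conjunct keeps the vertex of the
  one-vertex graph from counting as a cut vertex.
\<close>

definition cut_vertex :: "'a pair_pre_digraph \<Rightarrow> 'a \<Rightarrow> bool" where
  "cut_vertex G v \<longleftrightarrow> v \<in> pverts G \<and> \<not> connected (pre_digraph.del_vert (with_proj G) v) \<and>
     pverts G \<noteq> {v}"

definition connected_cut_graphs :: "nat \<Rightarrow> nat \<Rightarrow> 'a pair_pre_digraph set" where
  "connected_cut_graphs n k =
     {G. pair_graph G \<and> connected (with_proj G) \<and> card (pverts G) = n \<and>
         card {v. cut_vertex G v} = k}"

text \<open>
  The graph $L_{n,g}$ for $3 \le g \le n - 1$: the cycle $C_g$ runs through $0, \dots, g - 1$ and the
  path $P_{n-g+1}$ through $g - 1, \dots, n - 1$, so that the end $g - 1$ of the path is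
  the vertex at which the two are glued.
\<close>

definition lollipop :: "nat \<Rightarrow> nat \<Rightarrow> nat pair_pre_digraph" where
  "lollipop n g =
     \<lparr> pverts = {..<n},
       parcs = symcl ({(i, (i + 1) mod g) | i. i < g} \<union> {(i, i + 1) | i. g - 1 \<le> i \<and> i + 1 < n}) \<rparr>"

definition graph_isomorphic :: "'a pair_pre_digraph \<Rightarrow> 'b pair_pre_digraph \<Rightarrow> bool" where
  "graph_isomorphic G H \<longleftrightarrow> digraph_iso (with_proj G) (with_proj H)"

lemma pair_graph_lollipop:
  assumes "3 \<le> g" "g \<le> n - 1"
  shows "pair_graph (lollipop n g)"
proof -
  define A where "A = {(i, (i + 1) mod g) | i. i < g} \<union> {(i, i + 1) | i. g - 1 \<le> i \<and> i + 1 < n}"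
  have A: "a < n \<and> b < n \<and> a \<noteq> b" if "(a, b) \<in> A" for a b
    using that unfolding A_def
  proof
    assume "(a, b) \<in> {(i, (i + 1) mod g) | i. i < g}"
    then have b: "b = (a + 1) mod g" and "a < g" by blast+
    then have "b \<noteq> a"
      using assms by (cases "a + 1 = g"; simp)
    moreover have "b < n" "a < n"
      using assms \<open>a < g\<close> mod_less_divisor[of g "a + 1"] unfolding b by linarith+
    ultimately show ?thesis
      by simp
  qed auto
  have parcs: "parcs (lollipop n g) = symcl A" and pverts: "pverts (lollipop n g) = {..<n}"
    by (simp_all add: lollipop_def A_def)
  have S: "a < n \<and> b < n \<and> a \<noteq> b" if "(a, b) \<in> symcl A" for a b
    using that A[of a b] A[of b a] unfolding symcl_def by auto
  have "sym (symcl A)"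
    unfolding symcl_def by (rule symI) auto
  moreover have "symcl A \<subseteq> {..<n} \<times> {..<n}"
    using S by auto
  then have "finite (symcl A)"
    by (rule finite_subset) simp
  ultimately show ?thesis
    using S by unfold_locales (auto simp: symmetric_def parcs pverts)
qed

lemma graph_dist_sym:
  assumes "pair_graph G"
  shows "graph_dist G u v = graph_dist G v u"
proof -
  interpret pair_graph G by (rule assms)
  have length_rev_path: "length (rev_path p) = length p" for p :: "('a \<times> 'a) awalk"
    by (induct p) auto
  have "\<exists>q. apath v q u \<and> length q = length p" if "apath u p v" for u v p
  proof -
    have "apath v (rev_path p) u"
      using that by simp
    then show ?thesis
      using length_rev_path[of p] by (intro exI conjI)
  qed
  then have "(\<exists>p. apath u p v \<and> length p = k) \<longleftrightarrow> (\<exists>p. apath v p u \<and> length p = k)" for k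
    by metis
  then show ?thesis
    by (simp add: graph_dist_def)
qed

end

theory Submission
  imports Defs
begin

text \<open>
  Split a connected graph at a cut vertex \<open>c\<close> that is farthest from some root: one side \<open>B\<close> has no cut
  vertex except possibly \<open>c\<close>, and the other side \<open>A\<close> has exactly one cut vertex less than the whole
  graph. The Wiener index of the whole is the sum of the two Wiener indices and of two terms
  \<open>(card B - 1) * D\<^sub>A(c)\<close> and \<open>(card A - 1) * D\<^sub>B(c)\<close>, where \<open>D(c)\<close> is the sum of the distances
  from \<open>c\<close>. A singleton distance layer that is not the last one consists of a cut vertex, so \<open>D(c)\<close> is
  bounded in terms of the number of cut vertices. Removing cut vertices one at a time, this yields the
  sharp bound for three cut vertices as soon as \<open>n \<ge> 14\<close>, with equality only if \<open>B\<close> has two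
  vertices or \<open>A\<close> has four. In the first case the distance layers force a second splitting of the
  other kind; there \<open>A\<close> is a path starting in \<open>c\<close>, and all distance layers of \<open>B\<close> have maximal
  depth, so \<open>B\<close> is 2-regular, i.e. a cycle.
\<close>

section \<open>Distances, cut vertices and splitting\<close>


text \<open>The obstacle is that \<open>B\<close> may consist of several pieces glued at
  \<open>c\<close>: its Wiener index alone can then exceed that of a cycle of the same size (the
  star beats \<open>C\<^sub>4\<close>). Adding \<open>2 * g * D(c)\<close>, the share of
  \<open>g\<close> vertices outside \<open>B\<close>, repairs this, because such a \<open>c\<close>
  has a small transmission; only a three-vertex \<open>B\<close> keeps an excess of 2. This excess
  and the small graphs that beat the lollipop are carried through the recursion as corrections and
  are absorbed for large \<open>n\<close>. The number 14 comes from two even cycles of lengths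
  \<open>2 * x + 2\<close> and \<open>2 * y + 2\<close> joined by a path with one inner vertex. Here
  \<open>n = 2 * (x + y) + 5\<close>, and twice the Wiener index falls short of the lollipop by
  \<open>2 * x * y * (x + y - 4)\<close>, which is 0 at \<open>n = 13\<close>. For the lollipop a
  lower bound on the distances suffices: the common bound \<open>wbound3 n\<close> then lies between
  the two indices, and their equality forces equality with the bound.\<close>

text \<open>Connectivity as the absence of a proper nonempty arc-closed subset: a proof of
  connectivity then consists in naming a closed set, without handling walks.\<close>

definition conn :: "'a rel \<Rightarrow> 'a set \<Rightarrow> bool" where
  "conn E U \<longleftrightarrow> U \<noteq> {} \<and> (\<forall>S. S \<subseteq> U \<and> S \<noteq> {} \<and> (\<forall>x\<in>S. \<forall>y\<in>U. (x, y) \<in> E \<longrightarrow> y \<in> S) \<longrightarrow> S = U)"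

definition sdist :: "'a rel \<Rightarrow> 'a set \<Rightarrow> 'a \<Rightarrow> 'a \<Rightarrow> nat" where
  "sdist E U u v = (LEAST k. (u, v) \<in> (Restr E U) ^^ k)"

definition transmission :: "'a rel \<Rightarrow> 'a set \<Rightarrow> 'a \<Rightarrow> nat" where
  "transmission E U v = (\<Sum>u\<in>U. sdist E U v u)"

text \<open>The sum over ordered pairs, i.e. twice the Wiener index.\<close>

definition wiener2 :: "'a rel \<Rightarrow> 'a set \<Rightarrow> nat" where
  "wiener2 E U = (\<Sum>v\<in>U. transmission E U v)"

definition is_cut :: "'a rel \<Rightarrow> 'a set \<Rightarrow> 'a \<Rightarrow> bool" where
  "is_cut E U c \<longleftrightarrow> c \<in> U \<and> \<not> conn E (U - {c}) \<and> U \<noteq> {c}"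

text \<open>Together with \<open>descending\<close> this forms a certificate for distances: if
  \<open>f\<close> is 0 at the root, \<open>lip\<close> makes it a lower bound of the distance,
  while \<open>descending\<close> makes it an upper bound. Distances in split graphs, in isomorphic
  copies and in the lollipop are treated this way.\<close>

definition lip :: "'a rel \<Rightarrow> 'a set \<Rightarrow> ('a \<Rightarrow> nat) \<Rightarrow> bool" where
  "lip E U f \<longleftrightarrow> (\<forall>x\<in>U. \<forall>y\<in>U. (x, y) \<in> E \<longrightarrow> f y \<le> Suc (f x))"

definition descending :: "'a rel \<Rightarrow> 'a set \<Rightarrow> 'a \<Rightarrow> ('a \<Rightarrow> nat) \<Rightarrow> bool" where
  "descending E U v f \<longleftrightarrow> (\<forall>x\<in>U. x \<noteq> v \<longrightarrow> (\<exists>y\<in>U. (y, x) \<in> E \<and> f x = Suc (f y)))"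

text \<open>A side may be just \<open>{c}\<close> and \<open>c\<close> need not be a cut vertex, so
  the notion survives the deletion of another vertex.\<close>

definition split_at :: "'a rel \<Rightarrow> 'a set \<Rightarrow> 'a set \<Rightarrow> 'a set \<Rightarrow> 'a \<Rightarrow> bool" where
  "split_at E V A B c \<longleftrightarrow> V = A \<union> B \<and> A \<inter> B = {c} \<and>
     (\<forall>a\<in>A - {c}. \<forall>b\<in>B - {c}. (a, b) \<notin> E)"

lemma connI:
  assumes "U \<noteq> {}"
    and "\<And>S. S \<subseteq> U \<Longrightarrow> S \<noteq> {} \<Longrightarrow> (\<And>x y. x \<in> S \<Longrightarrow> y \<in> U \<Longrightarrow> (x, y) \<in> E \<Longrightarrow> y \<in> S) \<Longrightarrow> U \<subseteq> S"
  shows "conn E U"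
  unfolding conn_def
proof (intro conjI allI impI assms(1))
  fix S assume "S \<subseteq> U \<and> S \<noteq> {} \<and> (\<forall>x\<in>S. \<forall>y\<in>U. (x, y) \<in> E \<longrightarrow> y \<in> S)"
  then show "S = U" using assms(2)[of S] by (intro equalityI) simp_all
qed

lemma connD:
  assumes "conn E U" "S \<subseteq> U" "S \<noteq> {}"
    and "\<And>x y. x \<in> S \<Longrightarrow> y \<in> U \<Longrightarrow> (x, y) \<in> E \<Longrightarrow> y \<in> S"
  shows "S = U"
  using assms(1)[unfolded conn_def, THEN conjunct2, rule_format, of S] assms(2-4) by simp

text \<open>Going down along \<open>g\<close> from \<open>x\<close> to \<open>v\<close>,
  \<open>g\<close> loses one per step, \<open>f\<close> loses at most one, and \<open>f\<close>
  arrives at 0.\<close>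

lemma lip_le_descending:
  assumes "lip E U f" "f v = 0" "descending E U v g" "x \<in> U"
  shows "f x \<le> g x"
  using assms(4)
proof (induction "g x" arbitrary: x rule: less_induct)
  case less
  show ?case
  proof (cases "x = v")
    case False
    then obtain y where y: "y \<in> U" "(y, x) \<in> E" "g x = Suc (g y)"
      using assms(3) less.prems unfolding descending_def by blast
    then have "f y \<le> g y" using less.hyps by simp
    moreover have "f x \<le> Suc (f y)" using assms(1) y less.prems unfolding lip_def by blast
    ultimately show ?thesis using y(3) by simp
  qed (simp add: assms(2))
qed

locale ugraph =
  fixes E :: "'a rel"
  assumes adj_sym: "(x, y) \<in> E \<Longrightarrow> (y, x) \<in> E"
    and adj_irrefl: "(x, x) \<notin> E"
begin

lemma relpow_reach:
  assumes "conn E U" "v \<in> U" "x \<in> U"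
  shows "\<exists>k. (v, x) \<in> (Restr E U) ^^ k"
proof -
  have "{x \<in> U. \<exists>k. (v, x) \<in> (Restr E U) ^^ k} = U"
  proof (rule connD[OF assms(1)])
    have "(v, v) \<in> (Restr E U) ^^ 0" by simp
    then show "{x \<in> U. \<exists>k. (v, x) \<in> (Restr E U) ^^ k} \<noteq> {}" using assms(2) by blast
  next
    fix x y assume "x \<in> {x \<in> U. \<exists>k. (v, x) \<in> (Restr E U) ^^ k}" "y \<in> U" "(x, y) \<in> E"
    then obtain k where "(v, x) \<in> (Restr E U) ^^ k" "(x, y) \<in> Restr E U" by blast
    then have "(v, y) \<in> (Restr E U) ^^ Suc k" by auto
    then show "y \<in> {x \<in> U. \<exists>k. (v, x) \<in> (Restr E U) ^^ k}" using \<open>y \<in> U\<close> by blast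
  qed blast
  then show ?thesis using assms(3) by blast
qed

lemma sdist_self [simp]: "sdist E U v v = 0"
  unfolding sdist_def by (rule Least_eq_0) simp

lemma sdist_relpow:
  assumes "conn E U" "v \<in> U" "x \<in> U"
  shows "(v, x) \<in> (Restr E U) ^^ sdist E U v x"
  unfolding sdist_def using relpow_reach[OF assms] by (rule LeastI_ex)

lemma sdist_le: "(v, x) \<in> (Restr E U) ^^ k \<Longrightarrow> sdist E U v x \<le> k"
  unfolding sdist_def by (rule Least_le)

lemma lip_sdist:
  assumes "conn E U" "v \<in> U"
  shows "lip E U (sdist E U v)"
  unfolding lip_def
proof (intro ballI impI)
  fix x y assume xy: "x \<in> U" "y \<in> U" "(x, y) \<in> E"
  then have "(v, y) \<in> (Restr E U) ^^ Suc (sdist E U v x)"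
    using sdist_relpow[OF assms xy(1)] by auto
  then show "sdist E U v y \<le> Suc (sdist E U v x)" by (rule sdist_le)
qed

lemma descending_sdist:
  assumes "conn E U" "v \<in> U"
  shows "descending E U v (sdist E U v)"
  unfolding descending_def
proof (intro ballI impI)
  fix x assume x: "x \<in> U" "x \<noteq> v"
  have p: "(v, x) \<in> (Restr E U) ^^ sdist E U v x" by (rule sdist_relpow[OF assms x(1)])
  obtain k where k: "sdist E U v x = Suc k"
    using p x(2) by (cases "sdist E U v x") auto
  then obtain y where y: "(v, y) \<in> (Restr E U) ^^ k" "(y, x) \<in> Restr E U"
    using p by auto
  have "sdist E U v y \<le> k" using y(1) by (rule sdist_le)
  moreover have "sdist E U v x \<le> Suc (sdist E U v y)"
    using lip_sdist[OF assms] y(2) unfolding lip_def by blast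
  ultimately show "\<exists>y\<in>U. (y, x) \<in> E \<and> sdist E U v x = Suc (sdist E U v y)"
    using k y(2) by (intro bexI[of _ y]) auto
qed

lemma sdist_eqI:
  assumes "conn E U" "v \<in> U" "lip E U f" "f v = 0" "descending E U v f" "x \<in> U"
  shows "sdist E U v x = f x"
  using lip_le_descending[OF assms(3,4) descending_sdist[OF assms(1,2)] assms(6)]
    lip_le_descending[OF lip_sdist[OF assms(1,2)] _ assms(5,6)] by simp

lemma sdist_geI:
  assumes "conn E U" "v \<in> U" "lip E U f" "f v = 0" "x \<in> U"
  shows "f x \<le> sdist E U v x"
  using lip_le_descending[OF assms(3,4) descending_sdist[OF assms(1,2)] assms(5)] .

lemma sdist_eq_0_iff:
  assumes "conn E U" "v \<in> U" "x \<in> U"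
  shows "sdist E U v x = 0 \<longleftrightarrow> x = v"
  using descending_sdist[OF assms(1,2)] assms(3) unfolding descending_def by (cases "x = v") auto

lemma relpow_Restr_sym: "(u, v) \<in> (Restr E U) ^^ k \<Longrightarrow> (v, u) \<in> (Restr E U) ^^ k"
proof (induction k arbitrary: v)
  case (Suc k)
  then obtain y where "(u, y) \<in> (Restr E U) ^^ k" "(y, v) \<in> Restr E U" by auto
  then have "(y, u) \<in> (Restr E U) ^^ k" "(v, y) \<in> Restr E U" using Suc.IH adj_sym by auto
  then show ?case by (rule relpow_Suc_I2[rotated])
qed auto

lemma sdist_sym: "sdist E U u v = sdist E U v u"
  unfolding sdist_def using relpow_Restr_sym by metis

section \<open>Splitting a graph at a vertex: connectivity, cut vertices, distances, Wiener
  index\<close>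

lemma split_at_commute: "split_at E V A B c \<Longrightarrow> split_at E V B A c"
  unfolding split_at_def by (auto dest: adj_sym)

text \<open>Since \<open>c\<close> is the only gate to \<open>B\<close>, a set closed in
  \<open>A\<close> is closed in \<open>V\<close> if it misses \<open>c\<close>, and becomes closed
  in \<open>V\<close> after adding \<open>B\<close> if it contains \<open>c\<close>.\<close>

lemma split_at_conn_left:
  assumes "split_at E V A B c" "conn E V"
  shows "conn E A"
proof (rule connI)
  show "A \<noteq> {}" using assms(1) unfolding split_at_def by blast
  fix S assume S: "S \<subseteq> A" "S \<noteq> {}" "\<And>x y. x \<in> S \<Longrightarrow> y \<in> A \<Longrightarrow> (x, y) \<in> E \<Longrightarrow> y \<in> S"
  show "A \<subseteq> S"
  proof (cases "c \<in> S")
    case True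
    have "S \<union> B = V"
    proof (rule connD[OF assms(2)])
      fix x y assume "x \<in> S \<union> B" "y \<in> V" "(x, y) \<in> E"
      then show "y \<in> S \<union> B"
        using S True assms(1) adj_sym[of x y] unfolding split_at_def by (cases "x = c") blast+
    qed (use S assms(1) in \<open>auto simp: split_at_def\<close>)
    moreover have "A \<inter> B = {c}" "A \<subseteq> V" using assms(1) unfolding split_at_def by auto
    ultimately show ?thesis using True by auto
  next
    case False
    have "S = V"
    proof (rule connD[OF assms(2)])
      fix x y assume "x \<in> S" "y \<in> V" "(x, y) \<in> E"
      moreover have "x \<in> A - {c}" using \<open>x \<in> S\<close> S(1) False by blast
      ultimately have "y \<in> A" using assms(1) unfolding split_at_def by (cases "y = c") blast+
      then show "y \<in> S" using S(3) \<open>x \<in> S\<close> \<open>(x, y) \<in> E\<close> by blast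
    qed (use S assms(1) in \<open>auto simp: split_at_def\<close>)
    then show ?thesis using assms(1) unfolding split_at_def by blast
  qed
qed

lemma split_at_conn_iff:
  assumes "split_at E V A B c"
  shows "conn E V \<longleftrightarrow> conn E A \<and> conn E B"
proof
  assume "conn E V"
  then show "conn E A \<and> conn E B"
    using split_at_conn_left assms split_at_commute by blast
next
  assume AB: "conn E A \<and> conn E B"
  show "conn E V"
  proof (rule connI)
    show "V \<noteq> {}" using assms unfolding split_at_def by blast
    fix S assume S: "S \<subseteq> V" "S \<noteq> {}" "\<And>x y. x \<in> S \<Longrightarrow> y \<in> V \<Longrightarrow> (x, y) \<in> E \<Longrightarrow> y \<in> S"
    have A: "S \<inter> A = A" if "S \<inter> A \<noteq> {}"
      by (rule connD[of E]) (use AB that S(3) assms in \<open>auto simp: split_at_def\<close>)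
    have B: "S \<inter> B = B" if "S \<inter> B \<noteq> {}"
      by (rule connD[of E]) (use AB that S(3) assms in \<open>auto simp: split_at_def\<close>)
    have "c \<in> A" "c \<in> B" "V = A \<union> B" using assms unfolding split_at_def by auto
    then show "V \<subseteq> S" using A B S(1,2) by blast
  qed
qed

text \<open>Deleting a vertex of \<open>A\<close> other than \<open>c\<close> leaves a splitting
  whose side \<open>B\<close> is untouched and connected, so the \<open>A\<close> side alone
  decides.\<close>

lemma split_at_is_cut_iff:
  assumes "split_at E V A B c" "conn E V" "x \<in> A" "x \<noteq> c"
  shows "is_cut E A x \<longleftrightarrow> is_cut E V x"
proof -
  have "x \<notin> B" using assms(1,3,4) unfolding split_at_def by (metis IntI singletonD)
  then have "split_at E (V - {x}) (A - {x}) B c"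
    using assms(1,4) unfolding split_at_def by (intro conjI) blast+
  moreover have "conn E B" using assms(1,2) split_at_conn_iff by blast
  ultimately have "conn E (V - {x}) \<longleftrightarrow> conn E (A - {x})" using split_at_conn_iff by blast
  moreover have "x \<in> V" "c \<in> V" "c \<in> A" using assms(1,3) unfolding split_at_def by blast+
  ultimately show ?thesis using assms(3,4) unfolding is_cut_def by blast
qed

text \<open>Every arc lies inside \<open>A\<close> or inside \<open>B\<close>; hence the formula on
  the right is \<open>lip\<close> and \<open>descending\<close> on all of \<open>V\<close>.\<close>

lemma split_at_sdist:
  assumes "split_at E V A B c" "conn E V" "v \<in> A" "x \<in> V"
  shows "sdist E V v x = (if x \<in> A then sdist E A v x else sdist E A v c + sdist E B c x)"
proof -
  have cA: "conn E A" and cB: "conn E B" using assms split_at_conn_iff by blast+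
  have V: "V = A \<union> B" and AB: "A \<inter> B = {c}" and c: "c \<in> A" "c \<in> B"
    and no: "\<And>a b. a \<in> A \<Longrightarrow> a \<noteq> c \<Longrightarrow> b \<in> B \<Longrightarrow> b \<noteq> c \<Longrightarrow> (a, b) \<notin> E \<and> (b, a) \<notin> E"
    using assms(1) adj_sym unfolding split_at_def by blast+
  define f where "f = (\<lambda>x. if x \<in> A then sdist E A v x else sdist E A v c + sdist E B c x)"
  have fB: "f x = sdist E A v c + sdist E B c x" if "x \<in> B" for x
    proof (cases "x \<in> A")
    case True
    then have "x = c" using that AB by blast
    then show ?thesis using c by (simp add: f_def)
  qed (simp add: f_def)
  have lA: "lip E A (sdist E A v)" "descending E A v (sdist E A v)"
    using lip_sdist descending_sdist cA assms(3) by blast+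
  have lB: "lip E B (sdist E B c)" "descending E B c (sdist E B c)"
    using lip_sdist descending_sdist cB c by blast+
  have "lip E V f"
    unfolding lip_def
  proof (intro ballI impI)
    fix x y assume xy: "x \<in> V" "y \<in> V" "(x, y) \<in> E"
    consider "x \<in> A" "y \<in> A" | "x \<in> B" "y \<in> B"
      using xy V no c by blast
    then show "f y \<le> Suc (f x)"
    proof cases
      case 1 then show ?thesis using lA(1) xy unfolding lip_def f_def by simp
    next
      case 2 then show ?thesis using lB(1) xy unfolding lip_def fB[OF 2(1)] fB[OF 2(2)] by simp
    qed
  qed
  moreover have "descending E V v f"
    unfolding descending_def
  proof (intro ballI impI)
    fix x assume x: "x \<in> V" "x \<noteq> v"
    show "\<exists>y\<in>V. (y, x) \<in> E \<and> f x = Suc (f y)"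
    proof (cases "x \<in> A")
      case True
      then obtain y where "y \<in> A" "(y, x) \<in> E" "sdist E A v x = Suc (sdist E A v y)"
        using lA(2) x unfolding descending_def by blast
      then show ?thesis using True V by (intro bexI[of _ y]) (auto simp: f_def)
    next
      case False
      then have xB: "x \<in> B" "x \<noteq> c" using x V c by auto
      then obtain y where "y \<in> B" "(y, x) \<in> E" "sdist E B c x = Suc (sdist E B c y)"
        using lB(2) unfolding descending_def by blast
      then show ?thesis using V xB by (intro bexI[of _ y]) (auto simp: fB)
    qed
  qed
  moreover have "f v = 0" using assms(3) by (simp add: f_def)
  moreover have "v \<in> V" using assms(3) V by simp
  ultimately show ?thesis using sdist_eqI[OF assms(2)] assms(4) unfolding f_def by blast
qed

lemma split_at_transmission:
  assumes "split_at E V A B c" "conn E V" "finite V" "v \<in> A"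
  shows "transmission E V v = transmission E A v + (card B - 1) * sdist E A v c + transmission E B c"
proof -
  have V: "V = A \<union> B" and AB: "A \<inter> B = {c}" and c: "c \<in> A" "c \<in> B"
    using assms(1) unfolding split_at_def by blast+
  have fin: "finite A" "finite B" using assms(3) V by auto
  have V': "V = A \<union> (B - {c})" "A \<inter> (B - {c}) = {}" using V AB c by auto
  have "transmission E V v = (\<Sum>x\<in>A. sdist E V v x) + (\<Sum>x\<in>B - {c}. sdist E V v x)"
    unfolding transmission_def V'(1) using V'(2) fin by (subst sum.union_disjoint) auto
  also have "(\<Sum>x\<in>A. sdist E V v x) = transmission E A v"
    unfolding transmission_def using split_at_sdist[OF assms(1,2,4)] V by (intro sum.cong) auto
  also have "(\<Sum>x\<in>B - {c}. sdist E V v x) = (\<Sum>x\<in>B - {c}. sdist E A v c + sdist E B c x)"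
    using split_at_sdist[OF assms(1,2,4)] V' by (intro sum.cong) auto
  also have "\<dots> = (card B - 1) * sdist E A v c + (\<Sum>x\<in>B - {c}. sdist E B c x)"
    using c fin by (simp add: sum.distrib)
  also have "(\<Sum>x\<in>B - {c}. sdist E B c x) = transmission E B c"
    unfolding transmission_def using sum.remove[OF fin(2) c(2), of "sdist E B c"] by simp
  finally show ?thesis by simp
qed

lemma transmission_sym: "(\<Sum>v\<in>U. sdist E U v c) = transmission E U c"
  unfolding transmission_def by (intro sum.cong refl sdist_sym)

text \<open>Each vertex of \<open>A\<close> reaches the \<open>card B - 1\<close> vertices of
  \<open>B - {c}\<close> through \<open>c\<close>, and conversely; the factors 2 count the pairs
  across in both orders.\<close>

lemma split_at_wiener2:
  assumes "split_at E V A B c" "conn E V" "finite V"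
  shows "wiener2 E V = wiener2 E A + wiener2 E B
    + 2 * (card B - 1) * transmission E A c + 2 * (card A - 1) * transmission E B c"
proof -
  have V: "V = A \<union> B" and AB: "A \<inter> B = {c}" and c: "c \<in> A" "c \<in> B"
    using assms(1) unfolding split_at_def by blast+
  have fin: "finite A" "finite B" using assms(3) V by auto
  have V': "V = A \<union> (B - {c})" "A \<inter> (B - {c}) = {}" using V AB c by auto
  have "wiener2 E V = (\<Sum>v\<in>A. transmission E V v) + (\<Sum>v\<in>B - {c}. transmission E V v)"
    unfolding wiener2_def V'(1) using V'(2) fin by (subst sum.union_disjoint) auto
  also have "(\<Sum>v\<in>A. transmission E V v) =
      wiener2 E A + (card B - 1) * transmission E A c + card A * transmission E B c"
    using split_at_transmission[OF assms]
    by (simp add: wiener2_def sum.distrib transmission_sym flip: sum_distrib_left)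
  also have "(\<Sum>v\<in>B - {c}. transmission E V v) =
      (\<Sum>v\<in>B - {c}. transmission E B v + (card A - 1) * sdist E B v c + transmission E A c)"
    using split_at_transmission[OF split_at_commute[OF assms(1)] assms(2,3)] by (intro sum.cong) auto
  also have "\<dots> = (\<Sum>v\<in>B - {c}. transmission E B v) + (card A - 1) * (\<Sum>v\<in>B - {c}. sdist E B v c)
      + (card B - 1) * transmission E A c"
    using c fin by (simp add: sum.distrib flip: sum_distrib_left)
  also have "(\<Sum>v\<in>B - {c}. sdist E B v c) = transmission E B c"
    using sum.remove[OF fin(2) c(2), of "\<lambda>v. sdist E B v c"] by (simp add: transmission_sym)
  \<comment> \<open>The sum over \<open>B - {c}\<close> lacks the row of \<open>c\<close>; adding it
    on both sides avoids a truncated subtraction.\<close>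
  finally have "wiener2 E V + transmission E B c = wiener2 E A + (card B - 1) * transmission E A c
      + card A * transmission E B c + wiener2 E B + (card A - 1) * transmission E B c
      + (card B - 1) * transmission E A c"
    unfolding wiener2_def[of E B] sum.remove[OF fin(2) c(2), of "transmission E B"] by simp
  moreover have "card A * transmission E B c = transmission E B c + (card A - 1) * transmission E B c"
    using c fin by (cases "card A") auto
  ultimately show ?thesis by (simp only: mult.assoc)
qed

text \<open>A shortest path from the root to another vertex never meets \<open>x\<close>: its
  earlier vertices are strictly closer to the root than its end, hence than
  \<open>x\<close>.\<close>

lemma farthest_not_cut:
  assumes "conn E V" "v \<in> V" "x \<in> V" "x \<noteq> v" "\<And>y. y \<in> V \<Longrightarrow> sdist E V v y \<le> sdist E V v x"
  shows "\<not> is_cut E V x"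
proof -
  have v_in: "v \<in> S" if S: "S \<subseteq> V - {x}" "S \<noteq> {}"
      "\<And>y z. y \<in> S \<Longrightarrow> z \<in> V - {x} \<Longrightarrow> (y, z) \<in> E \<Longrightarrow> z \<in> S" for S
  proof -
    obtain y where y: "y \<in> S" "\<And>z. z \<in> S \<Longrightarrow> sdist E V v y \<le> sdist E V v z"
      using S(2) ex_has_least_nat[of "\<lambda>y. y \<in> S" _ "sdist E V v"] by blast
    show ?thesis
    proof (cases "y = v")
      case False
      then obtain z where z: "z \<in> V" "(z, y) \<in> E" "sdist E V v y = Suc (sdist E V v z)"
        using descending_sdist[OF assms(1,2)] y(1) S(1) unfolding descending_def by blast
      moreover have "z \<noteq> x" using z(3) assms(5)[of y] y(1) S(1) by auto
      ultimately have "z \<in> S" using S(3)[of y z] y(1) adj_sym by blast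
      then show ?thesis using y(2) z(3) by fastforce
    qed (use y in simp)
  qed
  have "conn E (V - {x})"
  proof (rule connI)
    show "V - {x} \<noteq> {}" using assms by blast
    fix S assume S: "S \<subseteq> V - {x}" "S \<noteq> {}"
      "\<And>y z. y \<in> S \<Longrightarrow> z \<in> V - {x} \<Longrightarrow> (y, z) \<in> E \<Longrightarrow> z \<in> S"
    show "V - {x} \<subseteq> S"
    proof (rule ccontr)
      assume "\<not> V - {x} \<subseteq> S"
      \<comment> \<open>By symmetry of \<open>E\<close> the complement of a closed set is closed, so
        it contains \<open>v\<close> as well.\<close>
      then have "v \<in> V - {x} - S"
        using S adj_sym by (intro v_in) blast+
      moreover have "v \<in> S" by (rule v_in) (use S in blast)+
      ultimately show False by blast
    qed
  qed
  then show ?thesis unfolding is_cut_def by blast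
qed

text \<open>The root lies in \<open>A\<close>, so a cut vertex in \<open>B - {c}\<close> would be
  farther from \<open>r\<close> than \<open>c\<close>. And \<open>A - {c}\<close> is the component
  of \<open>r\<close>, so \<open>c\<close> does not cut \<open>A\<close>. The cut vertex
  \<open>c0\<close> other than \<open>r\<close> keeps the farthest one away from the root.\<close>

lemma extremal_split:
  assumes "finite V" "conn E V" "r \<in> V" "r \<noteq> c0" "is_cut E V c0"
  obtains c A B where "split_at E V A B c" "is_cut E V c" "r \<in> A" "r \<noteq> c" "B \<noteq> {c}"
    "{x. is_cut E A x} = {x. is_cut E V x} - {c}" "{x. is_cut E B x} \<subseteq> {c}"
    "\<And>x. is_cut E V x \<Longrightarrow> sdist E V r x \<le> sdist E V r c" "conn E (A - {c})"
proof -
  have fin: "finite {x. is_cut E V x}"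
    by (rule finite_subset[OF _ assms(1)]) (auto simp: is_cut_def)
  define m where "m = Max (sdist E V r ` {x. is_cut E V x})"
  have "m \<in> sdist E V r ` {x. is_cut E V x}"
    unfolding m_def using fin assms(5) by (intro Max_in) auto
  then obtain c where c: "is_cut E V c" "sdist E V r c = m" by auto
  have far: "sdist E V r x \<le> sdist E V r c" if "is_cut E V x" for x
    unfolding c(2) m_def using fin that by (intro Max_ge) auto
  have cV: "c \<in> V" using c(1) unfolding is_cut_def by blast
  have "sdist E V r c0 \<noteq> 0"
    using sdist_eq_0_iff[OF assms(2,3), of c0] assms(4,5) unfolding is_cut_def by blast
  then have "sdist E V r c \<noteq> 0" using far[OF assms(5)] by simp
  then have rc: "r \<noteq> c" by auto
  \<comment> \<open>The component of \<open>r\<close> after the deletion of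
    \<open>c\<close>.\<close>
  define A0 where "A0 = {x. (r, x) \<in> (Restr E (V - {c}))\<^sup>* \<and> x \<in> V - {c}}"
  have rA0: "r \<in> A0" using assms(3) rc unfolding A0_def by auto
  have A0cl: "y \<in> A0" if "x \<in> A0" "y \<in> V - {c}" "(x, y) \<in> E" for x y
  proof -
    have "(x, y) \<in> Restr E (V - {c})" using that unfolding A0_def by blast
    then show ?thesis using that unfolding A0_def by (auto intro: rtrancl_into_rtrancl)
  qed
  have A0V: "A0 \<subseteq> V - {c}" unfolding A0_def by blast
  have connA0: "conn E A0"
  proof (rule connI)
    fix S assume S: "S \<subseteq> A0" "S \<noteq> {}" "\<And>x y. x \<in> S \<Longrightarrow> y \<in> A0 \<Longrightarrow> (x, y) \<in> E \<Longrightarrow> y \<in> S"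
    have root_in: "r \<in> Q" if "Q \<subseteq> A0" "x \<in> Q" "\<And>x y. x \<in> Q \<Longrightarrow> y \<in> A0 \<Longrightarrow> (x, y) \<in> E \<Longrightarrow> y \<in> Q" for Q x
    proof -
      have "(r, x) \<in> (Restr E (V - {c}))\<^sup>*" using that unfolding A0_def by blast
      then show ?thesis using that(2)
      proof (induction rule: rtrancl_induct)
        case (step y z)
        have "(z, y) \<in> E" "y \<in> V - {c}" "z \<in> V - {c}" using step adj_sym by auto
        moreover have "z \<in> A0" using step.prems that(1) by blast
        ultimately have "y \<in> A0" using A0cl by blast
        then have "y \<in> Q" using that(3)[OF step.prems] \<open>(z, y) \<in> E\<close> by blast
        then show ?case by (rule step.IH)
      qed
    qed
    show "A0 \<subseteq> S"
    proof (rule ccontr)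
      assume "\<not> A0 \<subseteq> S"
      then obtain x where "x \<in> A0 - S" by blast
      then have "r \<in> A0 - S" by (rule root_in[rotated]) (use S adj_sym in blast)+
      moreover have "r \<in> S" using S(2) root_in[of S] S(1,3) by blast
      ultimately show False by blast
    qed
  qed (use rA0 in blast)
  define A where "A = insert c A0"
  define B where "B = V - A0"
  have sp: "split_at E V A B c"
    unfolding split_at_def A_def B_def using A0V cV A0cl by blast
  have "A0 \<noteq> V - {c}" using c(1) connA0 unfolding is_cut_def by metis
  then have Bc: "B \<noteq> {c}" using A0V cV unfolding B_def by blast
  have Ac: "A - {c} = A0" unfolding A_def using A0V by blast
  have cnotA: "\<not> is_cut E A c" unfolding is_cut_def Ac using connA0 by blast
  have noB: "x = c" if "is_cut E V x" "x \<in> B" for x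
  proof (rule ccontr)
    assume "x \<noteq> c"
    have connB: "conn E B" using sp assms(2) split_at_conn_iff by blast
    have "x \<in> V" "x \<notin> A" using that \<open>x \<noteq> c\<close> unfolding is_cut_def A_def B_def by auto
    then have "sdist E V r x = sdist E A r c + sdist E B c x"
      using split_at_sdist[OF sp assms(2), of r x] rA0 unfolding A_def by auto
    moreover have "sdist E V r c = sdist E A r c"
      using split_at_sdist[OF sp assms(2), of r c] rA0 cV unfolding A_def by auto
    moreover have "sdist E B c x \<noteq> 0"
      using sdist_eq_0_iff[OF connB, of c x] that(2) \<open>x \<noteq> c\<close> cV A0V unfolding B_def by auto
    ultimately show False using far[OF that(1)] by simp
  qed
  have rA: "r \<in> A" using rA0 unfolding A_def by simp
  have cutsA: "{x. is_cut E A x} = {x. is_cut E V x} - {c}"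
  proof (intro equalityI subsetI)
    fix x assume "x \<in> {x. is_cut E A x}"
    then have x: "is_cut E A x" "x \<in> A" "x \<noteq> c" using cnotA unfolding is_cut_def by auto
    then show "x \<in> {x. is_cut E V x} - {c}" using split_at_is_cut_iff[OF sp assms(2)] by blast
  next
    fix x assume x: "x \<in> {x. is_cut E V x} - {c}"
    then have "x \<in> A" using noB[of x] unfolding B_def A_def is_cut_def by blast
    then show "x \<in> {x. is_cut E A x}" using x split_at_is_cut_iff[OF sp assms(2)] by blast
  qed
  have cutsB: "{x. is_cut E B x} \<subseteq> {c}"
  proof
    fix x assume "x \<in> {x. is_cut E B x}"
    then have x: "is_cut E B x" "x \<in> B" unfolding is_cut_def by auto
    then show "x \<in> {c}"
      using noB[of x] split_at_is_cut_iff[OF split_at_commute[OF sp] assms(2), of x] by blast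
  qed
  show ?thesis
    using that[OF sp c(1) rA rc Bc cutsA cutsB far] connA0 Ac by simp
qed

end

section \<open>Numerical bounds\<close>


text \<open>\<open>qsq n\<close> is the transmission of a vertex of the cycle \<open>C\<^sub>n\<close>, and \<open>max_trans k n\<close> that of
  the end of a path through \<open>k\<close> cut vertices whose other end lies on \<open>C\<^bsub>n - k\<^esub>\<close>.\<close>

definition qsq :: "nat \<Rightarrow> nat" where
  "qsq n = n * n div 4"

primrec max_trans :: "nat \<Rightarrow> nat \<Rightarrow> nat" where
  "max_trans 0 n = qsq n"
| "max_trans (Suc k) n = max_trans k (n - 1) + (n - 1)"

lemma qsq_even: "qsq (2 * k) = k * k"
  unfolding qsq_def by simp

lemma qsq_odd: "qsq (2 * k + 1) = k * k + k"
proof -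
  have "(2 * k + 1) * (2 * k + 1) = 4 * (k * k + k) + 1" by (simp add: algebra_simps)
  then show ?thesis unfolding qsq_def by simp
qed

lemma qsq_shift:
  "qsq (2 * k + 2) = (k + 1) * (k + 1)" "qsq (2 * k + 3) = (k + 1) * (k + 1) + (k + 1)"
  "qsq (2 * k + 4) = (k + 2) * (k + 2)" "qsq (2 * k + 5) = (k + 2) * (k + 2) + (k + 2)"
proof -
  have e: "2 * k + 2 = 2 * (k + 1)" "2 * k + 3 = 2 * (k + 1) + 1"
    "2 * k + 4 = 2 * (k + 2)" "2 * k + 5 = 2 * (k + 2) + 1" by simp_all
  show "qsq (2 * k + 2) = (k + 1) * (k + 1)" "qsq (2 * k + 3) = (k + 1) * (k + 1) + (k + 1)"
    "qsq (2 * k + 4) = (k + 2) * (k + 2)" "qsq (2 * k + 5) = (k + 2) * (k + 2) + (k + 2)"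
    unfolding e qsq_even qsq_odd by simp_all
qed

lemma qsq_small [simp]: "qsq 0 = 0" "qsq (Suc 0) = 0" "qsq 2 = 1" "qsq 3 = 2" "qsq 4 = 4"
  by (simp_all add: qsq_def)

text \<open>Substituting by parity removes both the division in \<open>qsq\<close> and the truncated
  subtractions, so that the inequalities below become polynomial identities with an explicit
  difference.\<close>

lemma nat_parity_shift:
  assumes "k \<le> (n :: nat)"
  obtains x where "n = 2 * x + k" | x where "n = 2 * x + (k + 1)"
proof (cases "even (n - k)")
  case True
  then obtain x where "n - k = 2 * x" by blast
  then have "n = 2 * x + k" using assms by simp
  then show ?thesis by (rule that(1))
next
  case False
  then obtain x where "n - k = 2 * x + 1" by (elim oddE)
  then have "n = 2 * x + (k + 1)" using assms by simp
  then show ?thesis by (rule that(2))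
qed

text \<open>Twice the Wiener index of \<open>L\<^bsub>n, n - k\<^esub>\<close> for \<open>k = 1, 2, 3\<close>, corrected where the recursion gives
  more: the star beats the lollipop at \<open>n = 4\<close>, so do the spider with legs 2, 1, 1 at \<open>n = 5\<close> and
  the star glued at a leaf to \<open>C\<^sub>4\<close> at \<open>n = 7\<close>.\<close>

definition wbound1 :: "nat \<Rightarrow> nat" where
  "wbound1 n = (n - 1 + 2) * qsq (n - 1) + 2 * (n - 1) + (if n = 4 then 2 else 0)"

definition wbound2 :: "nat \<Rightarrow> nat" where
  "wbound2 n = (n - 2 + 4) * qsq (n - 2) + 6 * (n - 2) + 2 + (if n = 5 \<or> n = 7 then 2 else 0)"

definition wbound3 :: "nat \<Rightarrow> nat" where
  "wbound3 n = (n - 3 + 6) * qsq (n - 3) + 12 * (n - 3) + 8"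

section \<open>Inequalities that drive the recursion on the number of cut vertices\<close>

lemma max_trans_1: "max_trans 1 h = qsq (h - 1) + (h - 1)"
  by simp

lemma max_trans_2: "max_trans 2 h = qsq (h - 2) + (h - 2) + (h - 1)"
  by (simp add: numeral_2_eq_2)

text \<open>Here \<open>b\<close> and \<open>h\<close> are the sizes of \<open>B\<close> and
  \<open>A\<close>. The difference of the two sides has no negative coefficients in any parity case;
  the correction for \<open>b = 3\<close> is critical only at \<open>h = 2\<close>, the size of the
  star on four vertices.\<close>

lemma wbound1_step:
  assumes "2 \<le> b" "2 \<le> h"
  shows "(b + 2 * (h - 1)) * qsq b + (if b = 3 then 2 else 0) + 2 * (b - 1) * qsq h + h * qsq h
    \<le> wbound1 (b + h - 1)"
proof -
  define L where "L = (b + 2 * (h - 1)) * qsq b + 2 * (b - 1) * qsq h + h * qsq h"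
  define R where "R = (b + h - 1 - 1 + 2) * qsq (b + h - 1 - 1) + 2 * (b + h - 1 - 1)"
  have L: "(b + 2 * (h - 1)) * qsq b + (if b = 3 then 2 else 0) + 2 * (b - 1) * qsq h + h * qsq h
      = L + (if b = 3 then 2 else 0)" unfolding L_def by simp
  have R: "wbound1 (b + h - 1) = R + (if b + h - 1 = 4 then 2 else 0)"
    unfolding R_def wbound1_def by simp
  show ?thesis
    unfolding L R
  proof (rule nat_parity_shift[OF assms(1)]; rule nat_parity_shift[OF assms(2)])
    fix x y assume b: "b = 2 * x + 2" and h: "h = 2 * y + 2"
    have n: "b + h - 1 - 1 = 2 * (x + y) + 2" and h1: "h - 1 = 2 * y + 1" "b - 1 = 2 * x + 1"
      using b h by simp_all
    have "L + 2 * x * y * (x + y) = R"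
      unfolding L_def R_def n h1 unfolding b h qsq_shift by (simp add: algebra_simps)
    moreover have "b \<noteq> 3" using b by presburger
    ultimately show "L + (if b = 3 then 2 else 0) \<le> R + (if b + h - 1 = 4 then 2 else 0)" by simp
  next
    fix x y assume b: "b = 2 * x + 2" and "h = 2 * y + (2 + 1)"
    then have h: "h = 2 * y + 3" by simp
    have n: "b + h - 1 - 1 = 2 * (x + y) + 3" and h1: "h - 1 = 2 * y + 2" "b - 1 = 2 * x + 1"
      using b h by simp_all
    have "L + x * (2 * x * y + x + 2 * y * y + 2 * y + 1) = R"
      unfolding L_def R_def n h1 unfolding b h qsq_shift by (simp add: algebra_simps)
    moreover have "b \<noteq> 3" using b by presburger
    ultimately show "L + (if b = 3 then 2 else 0) \<le> R + (if b + h - 1 = 4 then 2 else 0)" by simp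
  next
    fix x y assume "b = 2 * x + (2 + 1)" and h: "h = 2 * y + 2"
    then have b: "b = 2 * x + 3" by simp
    have n: "b + h - 1 - 1 = 2 * (x + y) + 3" and h1: "h - 1 = 2 * y + 1" "b - 1 = 2 * x + 2"
      using b h by simp_all
    have "L + y * (2 * x * x + 2 * x * y + 2 * x + y + 1) = R"
      unfolding L_def R_def n h1 unfolding b h qsq_shift by (simp add: algebra_simps)
    moreover have "y = 0 \<or> 2 \<le> y * (2 * x * x + 2 * x * y + 2 * x + y + 1)"
      by (cases y) simp_all
    moreover have "y = 0 \<Longrightarrow> b = 3 \<Longrightarrow> b + h - 1 = 4" using h by simp
    ultimately show "L + (if b = 3 then 2 else 0) \<le> R + (if b + h - 1 = 4 then 2 else 0)" by auto
  next
    fix x y assume "b = 2 * x + (2 + 1)" and "h = 2 * y + (2 + 1)"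
    then have b: "b = 2 * x + 3" and h: "h = 2 * y + 3" by simp_all
    have n: "b + h - 1 - 1 = 2 * (x + y) + 4" and h1: "h - 1 = 2 * y + 2" "b - 1 = 2 * x + 2"
      using b h by simp_all
    have "L + (2 * x * x * y + x * x + 2 * x * y * y + 4 * x * y + 3 * x + y * y + 3 * y + 4) = R"
      unfolding L_def R_def n h1 unfolding b h qsq_shift by (simp add: algebra_simps)
    then show "L + (if b = 3 then 2 else 0) \<le> R + (if b + h - 1 = 4 then 2 else 0)" by simp
  qed
qed

text \<open>The differences now contain negative terms, hence the passage to \<open>int\<close>. A
  correction 2 on the left is absorbed unless \<open>h = 4\<close> with \<open>b\<close> equal to 2
  or 4, or \<open>b = 3\<close> with \<open>h\<close> equal to 3 or 5; these are the exceptional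
  sizes 5 and 7 in \<open>wbound2\<close>.\<close>

lemma wbound2_step:
  assumes "2 \<le> b" "3 \<le> h"
  shows "(b + 2 * (h - 1)) * qsq b + (if b = 3 then 2 else 0) + 2 * (b - 1) * max_trans 1 h + wbound1 h
    \<le> wbound2 (b + h - 1)"
proof -
  define L where "L = (b + 2 * (h - 1)) * qsq b + 2 * (b - 1) * max_trans 1 h
    + ((h - 1 + 2) * qsq (h - 1) + 2 * (h - 1))"
  define R where "R = (b + h - 1 - 2 + 4) * qsq (b + h - 1 - 2) + 6 * (b + h - 1 - 2) + 2"
  have L: "(b + 2 * (h - 1)) * qsq b + (if b = 3 then 2 else 0) + 2 * (b - 1) * max_trans 1 h + wbound1 h
      = L + (if b = 3 then 2 else 0) + (if h = 4 then 2 else 0)" unfolding L_def wbound1_def by simp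
  have R: "wbound2 (b + h - 1) = R + (if b + h - 1 = 5 \<or> b + h - 1 = 7 then 2 else 0)"
    unfolding R_def wbound2_def by simp
  show ?thesis
    unfolding L R
  proof (rule nat_parity_shift[OF assms(1)]; rule nat_parity_shift[OF assms(2)])
    fix x y assume b: "b = 2 * x + 2" and h: "h = 2 * y + 3"
    have n: "b + h - 1 - 2 = 2 * (x + y) + 2" and h1: "h - 1 = 2 * y + 2" "b - 1 = 2 * x + 1"
      using b h by simp_all
    have "int L + 2 * int x * int y * (int x + int y - 2) = int R"
      unfolding L_def R_def max_trans_1 n h1 unfolding b h qsq_shift by (simp add: algebra_simps)
    moreover have "2 * int x * int y * (int x + int y - 2) \<ge> 0"
      by (cases "x = 0 \<or> y = 0") auto
    moreover have "b \<noteq> 3" "h \<noteq> 4" using b h by presburger+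
    ultimately show "L + (if b = 3 then 2 else 0) + (if h = 4 then 2 else 0)
      \<le> R + (if b + h - 1 = 5 \<or> b + h - 1 = 7 then 2 else 0)" by simp
  next
    fix x y assume b: "b = 2 * x + 2" and "h = 2 * y + (3 + 1)"
    then have h: "h = 2 * y + 4" by simp
    have n: "b + h - 1 - 2 = 2 * (x + y) + 3" and h1: "h - 1 = 2 * y + 3" "b - 1 = 2 * x + 1"
      using b h by simp_all
    have id: "int L + int x * ((2 * int y + 1) * (int x - 1) + 2 * int y * int y) = int R"
      unfolding L_def R_def max_trans_1 n h1 unfolding b h qsq_shift by (simp add: algebra_simps)
    have "int x * ((2 * int y + 1) * (int x - 1) + 2 * int y * int y) \<ge> 0"
      by (cases x) auto
    then have le: "L \<le> R" using id by linarith
    have two: "int x * ((2 * int y + 1) * (int x - 1) + 2 * int y * int y) \<ge> 2"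
      if "h = 4" "x \<noteq> 0" "x \<noteq> 1"
    proof -
      have "y = 0" using that(1) h by simp
      moreover have "2 * 1 \<le> int x * (int x - 1)" using that(2,3) by (intro mult_mono) auto
      ultimately show ?thesis by simp
    qed
    have le2: "L + 2 \<le> R" if "h = 4" "x \<noteq> 0" "x \<noteq> 1"
      using id two[OF that] by linarith
    have "b \<noteq> 3" using b by presburger
    moreover have "h = 4 \<Longrightarrow> x = 0 \<or> x = 1 \<Longrightarrow> b + h - 1 = 5 \<or> b + h - 1 = 7" using b by auto
    ultimately show "L + (if b = 3 then 2 else 0) + (if h = 4 then 2 else 0)
      \<le> R + (if b + h - 1 = 5 \<or> b + h - 1 = 7 then 2 else 0)"
      using le le2 by (cases "h = 4"; cases "x = 0 \<or> x = 1") auto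
  next
    fix x y assume "b = 2 * x + (2 + 1)" and h: "h = 2 * y + 3"
    then have b: "b = 2 * x + 3" by simp
    have n: "b + h - 1 - 2 = 2 * (x + y) + 3" and h1: "h - 1 = 2 * y + 2" "b - 1 = 2 * x + 2"
      using b h by simp_all
    have id: "int L + int y * ((2 * int x + 1) * (int y - 1) + 2 * int x * int x) = int R"
      unfolding L_def R_def max_trans_1 n h1 unfolding b h qsq_shift by (simp add: algebra_simps)
    have "int y * ((2 * int x + 1) * (int y - 1) + 2 * int x * int x) \<ge> 0"
      by (cases y) auto
    then have le: "L \<le> R" using id by linarith
    have two: "int y * ((2 * int x + 1) * (int y - 1) + 2 * int x * int x) \<ge> 2"
      if "b = 3" "y \<noteq> 0" "y \<noteq> 1"
    proof -
      have "x = 0" using that(1) b by simp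
      moreover have "2 * 1 \<le> int y * (int y - 1)" using that(2,3) by (intro mult_mono) auto
      ultimately show ?thesis by simp
    qed
    have le2: "L + 2 \<le> R" if "b = 3" "y \<noteq> 0" "y \<noteq> 1"
      using id two[OF that] by linarith
    have "h \<noteq> 4" using h by presburger
    moreover have "b = 3 \<Longrightarrow> y = 0 \<or> y = 1 \<Longrightarrow> b + h - 1 = 5 \<or> b + h - 1 = 7" using h by auto
    ultimately show "L + (if b = 3 then 2 else 0) + (if h = 4 then 2 else 0)
      \<le> R + (if b + h - 1 = 5 \<or> b + h - 1 = 7 then 2 else 0)"
      using le le2 by (cases "b = 3"; cases "y = 0 \<or> y = 1") auto
  next
    fix x y assume "b = 2 * x + (2 + 1)" and "h = 2 * y + (3 + 1)"
    then have b: "b = 2 * x + 3" and h: "h = 2 * y + 4" by simp_all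
    have n: "b + h - 1 - 2 = 2 * (x + y) + 4" and h1: "h - 1 = 2 * y + 3" "b - 1 = 2 * x + 2"
      using b h by simp_all
    have "L + (2 * x * x * y + x * x + 2 * x * y * y + x + y * y + y + 4) = R"
      unfolding L_def R_def max_trans_1 n h1 unfolding b h qsq_shift by (simp add: algebra_simps)
    then show "L + (if b = 3 then 2 else 0) + (if h = 4 then 2 else 0)
      \<le> R + (if b + h - 1 = 5 \<or> b + h - 1 = 7 then 2 else 0)" by simp
  qed
qed

text \<open>The summand 1 on the left is a strict gap: it is what confines equality to
  \<open>b = 2\<close> or \<open>h = 4\<close>.\<close>

lemma wbound3_step:
  assumes "2 \<le> b" "4 \<le> h" "15 \<le> b + h"
  shows "(b + 2 * (h - 1)) * qsq b + (if b = 3 then 2 else 0) + 2 * (b - 1) * max_trans 2 h + wbound2 h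
      + (if b = 2 \<or> h = 4 then 0 else 1) \<le> wbound3 (b + h - 1)"
proof -
  define L where "L = (b + 2 * (h - 1)) * qsq b + 2 * (b - 1) * max_trans 2 h
    + ((h - 2 + 4) * qsq (h - 2) + 6 * (h - 2) + 2)"
  define R where "R = (b + h - 1 - 3 + 6) * qsq (b + h - 1 - 3) + 12 * (b + h - 1 - 3) + 8"
  define e :: nat where "e = (if b = 3 then 2 else 0) + (if h = 5 \<or> h = 7 then 2 else 0)
    + (if b = 2 \<or> h = 4 then 0 else 1)"
  have L: "(b + 2 * (h - 1)) * qsq b + (if b = 3 then 2 else 0) + 2 * (b - 1) * max_trans 2 h + wbound2 h
      + (if b = 2 \<or> h = 4 then 0 else 1) = L + e"
    unfolding L_def wbound2_def e_def by simp
  have R: "wbound3 (b + h - 1) = R"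
    unfolding R_def wbound3_def by simp
  have lift: "L + e \<le> R" if "int L + d = int R" "int e \<le> d" for d using that by linarith
  show ?thesis
    unfolding L R
  proof (rule nat_parity_shift[OF assms(1)]; rule nat_parity_shift[OF assms(2)])
    fix x y assume b: "b = 2 * x + 2" and h: "h = 2 * y + 4"
    have n: "b + h - 1 - 3 = 2 * (x + y) + 2" and h1: "h - 1 = 2 * y + 3" "b - 1 = 2 * x + 1" "h - 2 = 2 * y + 2"
      using b h by simp_all
    have id: "int L + 2 * int x * int y * (int x + int y - 4) = int R"
      unfolding L_def R_def max_trans_2 n h1 unfolding b h qsq_shift by (simp add: algebra_simps)
    have "b \<noteq> 3" "h \<noteq> 5" "h \<noteq> 7" using b h by presburger+
    then have e: "e = (if x = 0 \<or> y = 0 then 0 else 1)" using b h by (simp add: e_def)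
    \<comment> \<open>Here \<open>b + h = 2 * (x + y) + 6\<close>, so by parity 15 forces
      \<open>x + y\<close> to be at least 5. This is the case that fixes the lower bound on the
      size.\<close>
    have xy: "1 \<le> int x + int y - 4" using assms(3) b h by linarith
    show "L + e \<le> R"
    proof (rule lift[OF id], cases "x = 0 \<or> y = 0")
      case False
      then have "1 * 1 * 1 \<le> 2 * int x * int y * (int x + int y - 4)"
        using xy by (intro mult_mono) auto
      then show "int e \<le> 2 * int x * int y * (int x + int y - 4)" using e by simp
    qed (use e in auto)
  next
    fix x y assume b: "b = 2 * x + 2" and "h = 2 * y + (4 + 1)"
    then have h: "h = 2 * y + 5" by simp
    have n: "b + h - 1 - 3 = 2 * (x + y) + 3" and h1: "h - 1 = 2 * y + 4" "b - 1 = 2 * x + 1" "h - 2 = 2 * y + 3"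
      using b h by simp_all
    have id: "int L + int x * ((2 * int y + 1) * (int x + int y - 4) + (int y + 1)) = int R"
      unfolding L_def R_def max_trans_2 n h1 unfolding b h qsq_shift by (simp add: algebra_simps)
    have "b \<noteq> 3" "h \<noteq> 4" using b h by presburger+
    then have e: "e = (if y = 0 \<or> y = 1 then 2 else 0) + (if x = 0 then 0 else 1)"
      using b h by (simp add: e_def)
    have xy: "0 \<le> int x + int y - 4" using assms(3) b h by linarith
    have *: "int x * (0 + (int y + 1)) \<le> int x * ((2 * int y + 1) * (int x + int y - 4) + (int y + 1))"
      using xy by (intro mult_left_mono add_mono) auto
    have "int e \<le> int x * (0 + (int y + 1))"
    proof (cases "y = 0 \<or> y = 1")
      case True
      then have "3 \<le> x" using xy by auto
      then have "int 3 * 1 \<le> int x * (0 + (int y + 1))" by (intro mult_mono) auto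
      then show ?thesis using e \<open>3 \<le> x\<close> by simp
    next
      case False
      have "x = 0 \<or> 1 * 1 \<le> int x * (0 + (int y + 1))" by (cases x) (auto simp: algebra_simps)
      then show ?thesis using e False by auto
    qed
    then show "L + e \<le> R" using lift[OF id] * by linarith
  next
    fix x y assume "b = 2 * x + (2 + 1)" and h: "h = 2 * y + 4"
    then have b: "b = 2 * x + 3" by simp
    have n: "b + h - 1 - 3 = 2 * (x + y) + 3" and h1: "h - 1 = 2 * y + 3" "b - 1 = 2 * x + 2" "h - 2 = 2 * y + 2"
      using b h by simp_all
    have id: "int L + int y * ((2 * int x + 1) * (int x + int y - 4) + (int x + 1)) = int R"
      unfolding L_def R_def max_trans_2 n h1 unfolding b h qsq_shift by (simp add: algebra_simps)
    have "b \<noteq> 2" "h \<noteq> 5" "h \<noteq> 7" using b h by presburger+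
    then have e: "e = (if x = 0 then 2 else 0) + (if y = 0 then 0 else 1)"
      using b h by (simp add: e_def)
    have xy: "0 \<le> int x + int y - 4" using assms(3) b h by linarith
    have *: "int y * (0 + (int x + 1)) \<le> int y * ((2 * int x + 1) * (int x + int y - 4) + (int x + 1))"
      using xy by (intro mult_left_mono add_mono) auto
    have "int e \<le> int y * (0 + (int x + 1))"
    proof (cases "x = 0")
      case True
      then have "4 \<le> y" using xy by auto
      then show ?thesis using e True by simp
    next
      case False
      have "y = 0 \<or> 1 * 1 \<le> int y * (0 + (int x + 1))" by (cases y) (auto simp: algebra_simps)
      then show ?thesis using e False by auto
    qed
    then show "L + e \<le> R" using lift[OF id] * by linarith
  next
    fix x y assume "b = 2 * x + (2 + 1)" and "h = 2 * y + (4 + 1)"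
    then have b: "b = 2 * x + 3" and h: "h = 2 * y + 5" by simp_all
    have n: "b + h - 1 - 3 = 2 * (x + y) + 4" and h1: "h - 1 = 2 * y + 4" "b - 1 = 2 * x + 2" "h - 2 = 2 * y + 3"
      using b h by simp_all
    have id: "int L + (2 * int x * int y * (int x + int y - 2) + int x * (int x - 1) + int y * (int y - 1) + 4)
        = int R"
      unfolding L_def R_def max_trans_2 n h1 unfolding b h qsq_shift by (simp add: algebra_simps)
    have e: "e = (if x = 0 then 2 else 0) + (if y = 0 \<or> y = 1 then 2 else 0) + 1"
      using b h by (simp add: e_def)
    have xy: "4 \<le> int x + int y" using assms(3) b h by linarith
    have "0 \<le> 2 * int x * int y * (int x + int y - 2)" using xy by simp
    moreover have "0 \<le> int x * (int x - 1)" "0 \<le> int y * (int y - 1)" by (cases x; simp) (cases y; simp)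
    moreover have "int e \<le> 3" using e xy by auto
    ultimately show "L + e \<le> R" using lift[OF id] by linarith
  qed
qed

text \<open>Superadditivity of \<open>qsq\<close> makes the difference of the two sides increasing in \<open>g\<close>, so the case
  \<open>g = 1\<close> is the critical one.\<close>

lemma glue_step:
  assumes "2 \<le> a" "2 \<le> b" "1 \<le> g"
  shows "(a + 2 * (b - 1 + g)) * qsq a + (b + 2 * (a - 1 + g)) * qsq b + (if b = 3 then 2 else 0)
    + (if 6 \<le> a + b - 1 then 1 else 0)
    \<le> (a + b - 1 + 2 * g) * qsq (a + b - 1) + (if a + b - 1 = 3 then 2 else 0)"
proof -
  obtain z where z: "g = z + 1" using assms(3) by (metis add.commute le_iff_add)
  define L where "L = (a + 2 * b) * qsq a + (b + 2 * a) * qsq b"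
  define R where "R = (a + b - 1 + 2) * qsq (a + b - 1)"
  \<comment> \<open>The threshold 6 is sharp: an edge glued to \<open>C\<^sub>4\<close>, that is
    \<open>a = 2\<close> and \<open>b = 4\<close>, gives equality at size 5 with
    \<open>g = 1\<close>.\<close>
  define e :: nat where "e = (if b = 3 then 2 else 0) + (if 6 \<le> a + b - 1 then 1 else 0)"
  have L: "(a + 2 * (b - 1 + g)) * qsq a + (b + 2 * (a - 1 + g)) * qsq b + (if b = 3 then 2 else 0)
    + (if 6 \<le> a + b - 1 then 1 else 0) = L + e + 2 * z * (qsq a + qsq b)"
  proof -
    have "a + 2 * (b - 1 + g) = a + 2 * b + 2 * z" "b + 2 * (a - 1 + g) = b + 2 * a + 2 * z"
      using z assms by auto
    then show ?thesis unfolding L_def e_def by (simp only: distrib_left distrib_right add.assoc)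
  qed
  have R: "(a + b - 1 + 2 * g) * qsq (a + b - 1) = R + 2 * z * qsq (a + b - 1)"
    unfolding R_def z by (simp add: algebra_simps)
  have "qsq a + qsq b \<le> qsq (a + b - 1) \<and> L + e \<le> R + (if a + b - 1 = 3 then 2 else 0)"
  proof (rule nat_parity_shift[OF assms(1)]; rule nat_parity_shift[OF assms(2)])
    fix x y assume a: "a = 2 * x + 2" and b: "b = 2 * y + 2"
    have n: "a + b - 1 = 2 * (x + y) + 3" using a b by simp
    have "qsq a + qsq b + (2 * x * y + x + y) = qsq (a + b - 1)"
      unfolding n unfolding a b qsq_shift by (simp add: algebra_simps)
    \<comment> \<open>The only parity case in which \<open>L\<close> can exceed \<open>R\<close>,
      namely by 2 at \<open>x = y = 0\<close>. This is the path on three vertices, the origin of the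
      correction at size 3.\<close>
    moreover have "L + (2 * x * x * y + x * x + 2 * x * y * y + 6 * x * y + x + y * y + y) = R + 2"
      unfolding L_def R_def n unfolding a b qsq_shift by (simp add: algebra_simps)
    moreover have "e \<le> 1" "b \<noteq> 3" using a b unfolding e_def by presburger+
    moreover have "e + 2 \<le> (2 * x * x * y + x * x + 2 * x * y * y + 6 * x * y + x + y * y + y) + (if a + b - 1 = 3 then 2 else 0)"
    proof -
      have e: "e = (if 6 \<le> 2 * (x + y) + 3 then 1 else 0)" unfolding e_def n using \<open>b \<noteq> 3\<close> by simp
      consider "x = 0" "y = 0" | "x = 0" "y = 1" | "x = 1" "y = 0" | "1 \<le> x" "1 \<le> y" | "2 \<le> x" "y = 0" | "x = 0" "2 \<le> y" by linarith
      then show ?thesis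
      proof cases
        case 4
        then have "6 * 1 * 1 \<le> 6 * x * y" by (intro mult_mono) auto
        moreover have "e \<le> 1" using e by simp
        ultimately have "e + 2 \<le> 6 * x * y" by linarith
        then show ?thesis by (rule order_trans) simp
      next
        case 5
        then have "2 * 2 \<le> x * x" by (intro mult_mono) auto
        then show ?thesis using e 5 by simp
      next
        case 6
        then have "2 * 2 \<le> y * y" by (intro mult_mono) auto
        then show ?thesis using e 6 by simp
      qed (use e n in auto)
    qed
    ultimately show ?thesis by linarith
  next
    fix x y assume a: "a = 2 * x + 2" and "b = 2 * y + (2 + 1)"
    then have b: "b = 2 * y + 3" by simp
    have n: "a + b - 1 = 2 * (x + y) + 4" using a b by simp
    have "qsq a + qsq b + (2 * x * y + 2 * x + y + 1) = qsq (a + b - 1)"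
      unfolding n unfolding a b qsq_shift by (simp add: algebra_simps)
    moreover have "L + (2 * x * x * y + 2 * x * x + 2 * x * y * y + 8 * x * y + 6 * x + y * y + 3 * y + 2) = R"
      unfolding L_def R_def n unfolding a b qsq_shift by (simp add: algebra_simps)
    moreover have "e \<le> 6 * x + 3 * y + 2" unfolding e_def n using b by auto
    ultimately show ?thesis by linarith
  next
    fix x y assume "a = 2 * x + (2 + 1)" and b: "b = 2 * y + 2"
    then have a: "a = 2 * x + 3" by simp
    have n: "a + b - 1 = 2 * (x + y) + 4" using a b by simp
    have "qsq a + qsq b + (2 * x * y + x + 2 * y + 1) = qsq (a + b - 1)"
      unfolding n unfolding a b qsq_shift by (simp add: algebra_simps)
    moreover have "L + (2 * x * x * y + x * x + 2 * x * y * y + 8 * x * y + 3 * x + 2 * y * y + 6 * y + 2) = R"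
      unfolding L_def R_def n unfolding a b qsq_shift by (simp add: algebra_simps)
    moreover have "b \<noteq> 3" using b by presburger
    then have "e \<le> 2" unfolding e_def by simp
    ultimately show ?thesis by linarith
  next
    fix x y assume "a = 2 * x + (2 + 1)" and "b = 2 * y + (2 + 1)"
    then have a: "a = 2 * x + 3" and b: "b = 2 * y + 3" by simp_all
    have n: "a + b - 1 = 2 * (x + y) + 5" using a b by simp
    have "qsq a + qsq b + (2 * x * y + 2 * x + 2 * y + 2) = qsq (a + b - 1)"
      unfolding n unfolding a b qsq_shift by (simp add: algebra_simps)
    moreover have "L + (2 * x * x * y + 2 * x * x + 2 * x * y * y + 10 * x * y + 8 * x + 2 * y * y + 8 * y + 6) = R"
      unfolding L_def R_def n unfolding a b qsq_shift by (simp add: algebra_simps)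
    moreover have "e \<le> 3" unfolding e_def by simp
    ultimately show ?thesis by linarith
  qed
  then have "2 * z * (qsq a + qsq b) \<le> 2 * z * qsq (a + b - 1)"
    "L + e \<le> R + (if a + b - 1 = 3 then 2 else 0)" by simp_all
  then show ?thesis unfolding L R by linarith
qed

section \<open>Distance layers and upper bounds\<close>


lemma qsq_Suc_Suc: "qsq (Suc (Suc m)) = qsq m + Suc m"
proof -
  have "Suc (Suc m) * Suc (Suc m) = m * m + 4 * Suc m" by (simp add: algebra_simps)
  then show ?thesis unfolding qsq_def by (simp only: div_mult_self2)
qed

lemma qsq_mono_Suc: "qsq m \<le> qsq (Suc m)"
  unfolding qsq_def by (intro div_le_mono mult_mono) auto

lemma qsq_less_Suc: "1 \<le> m \<Longrightarrow> qsq m < qsq (Suc m)"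
proof (induction m rule: induct_nat_012)
  case (ge2 m)
  then show ?case using qsq_Suc_Suc[of m] qsq_Suc_Suc[of "Suc m"] qsq_mono_Suc[of m] by simp
qed (simp_all add: numeral_2_eq_2[symmetric])

lemma max_trans_mono_Suc: "max_trans k n \<le> max_trans k (Suc n)"
proof (induction k arbitrary: n)
  case (Suc k)
  show ?case using Suc.IH[of "n - 1"] by (cases n) (auto intro: le_SucI)
qed (simp add: qsq_mono_Suc)

lemma max_trans_mono: "m \<le> n \<Longrightarrow> max_trans k m \<le> max_trans k n"
  using lift_Suc_mono_le[of "max_trans k"] max_trans_mono_Suc by blast

text \<open>An equality for \<open>k = 0\<close>. It pays for peeling off a distance layer with two
  vertices.\<close>

lemma max_trans_Suc_Suc: "max_trans k n + Suc n \<le> max_trans k (Suc (Suc n))"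
proof (induction k arbitrary: n)
  case 0
  then show ?case using qsq_Suc_Suc by simp
next
  case (Suc k)
  show ?case
  proof (cases n)
    case (Suc n')
    then show ?thesis using Suc.IH[of n'] by simp
  qed (use max_trans_mono[of 0 1 k] in simp)
qed

lemma card_layers:
  fixes f :: "'a \<Rightarrow> nat"
  assumes "finite U"
  shows "card {u \<in> U. t < f u} = card {u \<in> U. f u = Suc t} + card {u \<in> U. Suc t < f u}"
proof -
  have "{u \<in> U. t < f u} = {u \<in> U. f u = Suc t} \<union> {u \<in> U. Suc t < f u}" by auto
  then show ?thesis using assms by (simp add: card_Un_disjoint disjoint_iff)
qed

lemma sum_layers:
  fixes f :: "'a \<Rightarrow> nat"
  assumes "finite U"
  shows "(\<Sum>u | u \<in> U \<and> t < f u. f u - t) = card {u \<in> U. t < f u} + (\<Sum>u | u \<in> U \<and> Suc t < f u. f u - Suc t)"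
proof -
  have "(\<Sum>u | u \<in> U \<and> t < f u. f u - t) = (\<Sum>u | u \<in> U \<and> t < f u. 1 + (f u - Suc t))"
    by (intro sum.cong) auto
  also have "\<dots> = card {u \<in> U. t < f u} + (\<Sum>u | u \<in> U \<and> t < f u. f u - Suc t)"
    unfolding sum.distrib by simp
  also have "(\<Sum>u | u \<in> U \<and> t < f u. f u - Suc t) = (\<Sum>u | u \<in> U \<and> Suc t < f u. f u - Suc t)"
    by (intro sum.mono_neutral_right) (use assms in auto)
  finally show ?thesis .
qed

locale layering =
  fixes U :: "'a set" and f :: "'a \<Rightarrow> nat" and K :: "'a set"
  assumes fin: "finite U"
    and layer_ne: "\<And>t. {u \<in> U. t < f u} \<noteq> {} \<Longrightarrow> {u \<in> U. f u = Suc t} \<noteq> {}"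
    and singleton_layer: "\<And>t c. {u \<in> U. f u = Suc t} = {c} \<Longrightarrow> {u \<in> U. Suc t < f u} \<noteq> {} \<Longrightarrow> c \<in> K"
begin

abbreviation beyond :: "nat \<Rightarrow> 'a set" where "beyond t \<equiv> {u \<in> U. t < f u}"
abbreviation excess :: "nat \<Rightarrow> nat" where "excess t \<equiv> (\<Sum>u | u \<in> U \<and> t < f u. f u - t)"
abbreviation layer :: "nat \<Rightarrow> 'a set" where "layer t \<equiv> {u \<in> U. f u = t}"

text \<open>The three ways to peel off a layer, on which the inductions below rest. A singleton
  before the last layer spends one element of \<open>K\<close>, the budget of the bound.\<close>

lemma layer_cases:
  assumes "beyond t \<noteq> {}"
  obtains "beyond (Suc t) = {}" "excess t = card (beyond t)" "card (layer (Suc t)) = card (beyond t)"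
  | "beyond (Suc t) \<noteq> {}" "2 \<le> card (layer (Suc t))"
  | c where "beyond (Suc t) \<noteq> {}" "layer (Suc t) = {c}" "c \<in> K"
      "card (beyond t) = Suc (card (beyond (Suc t)))" "card (K \<inter> beyond t) = Suc (card (K \<inter> beyond (Suc t)))"
proof (cases "beyond (Suc t) = {}")
  case True
  show thesis
    by (rule that(1)[OF True]) (use sum_layers[OF fin, where t = t and f = f] card_layers[OF fin, where t = t and f = f] True in \<open>simp_all only: sum.empty card.empty\<close>)
next
  case False
  show thesis
  proof (cases "2 \<le> card (layer (Suc t))")
    case True
    then show thesis using that(2) False by blast
  next
    case small: False
    have "card (layer (Suc t)) \<noteq> 0" using layer_ne[OF assms] fin by simp
    then have "card (layer (Suc t)) = 1" using small by linarith
    then obtain c where c: "layer (Suc t) = {c}" by (elim card_1_singletonE)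
    have cK: "c \<in> K" using singleton_layer[OF c False] .
    have "K \<inter> beyond t = insert c (K \<inter> beyond (Suc t))"
    proof -
      have "beyond t = insert c (beyond (Suc t))" using c by force
      then show ?thesis using cK by auto
    qed
    moreover have "c \<notin> beyond (Suc t)" using c by auto
    ultimately have "card (K \<inter> beyond t) = Suc (card (K \<inter> beyond (Suc t)))" using fin by simp
    moreover have "card (beyond t) = Suc (card (beyond (Suc t)))"
      using card_layers[OF fin, where t = t and f = f] c by simp
    ultimately show thesis using that(3)[OF False c cK] by blast
  qed
qed

text \<open>Peeling off a layer contributes \<open>card (beyond t)\<close>. For a singleton this is
  exactly the recursion of \<open>max_trans\<close>, which spends one unit of \<open>k\<close>;
  larger layers are covered by \<open>max_trans_Suc_Suc\<close>.\<close>

lemma excess_bound: "card (K \<inter> beyond t) \<le> k \<Longrightarrow> excess t \<le> max_trans k (Suc (card (beyond t)))"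
proof (induction "card (beyond t)" arbitrary: t k rule: less_induct)
  case less
  show ?case
  proof (cases "beyond t = {}")
    case False
    show ?thesis
      using False
    proof (cases rule: layer_cases)
      case 1
      have "card (beyond t) \<noteq> 0" using False fin by simp
      then have "card (beyond t) \<le> max_trans k (Suc (card (beyond t)))"
        using max_trans_Suc_Suc[of k "card (beyond t) - 1"] by simp
      then show ?thesis using 1(2) by simp
    next
      case 2
      have m: "card (beyond (Suc t)) + 2 \<le> card (beyond t)"
        using card_layers[OF fin, where t = t and f = f] 2(2) by simp
      have "card (K \<inter> beyond (Suc t)) \<le> card (K \<inter> beyond t)"
        by (intro card_mono) (use fin in auto)
      then have "excess (Suc t) \<le> max_trans k (Suc (card (beyond (Suc t))))"
        using less.hyps[of "Suc t" k] less.prems m by simp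
      also have "\<dots> \<le> max_trans k (card (beyond t) - 1)" using m by (intro max_trans_mono) simp
      finally show ?thesis
        using sum_layers[OF fin, where t = t and f = f] max_trans_Suc_Suc[of k "card (beyond t) - 1"] m by simp
    next
      case (3 c)
      then obtain k' where k: "k = Suc k'" using less.prems by (cases k) auto
      then have "excess (Suc t) \<le> max_trans k' (Suc (card (beyond (Suc t))))"
        using less.hyps[of "Suc t" k'] less.prems 3 by simp
      then show ?thesis using sum_layers[OF fin, where t = t and f = f] 3(4) k by simp
    qed
  next
    case True
    show ?thesis unfolding True by simp
  qed
qed

text \<open>While budget is left, a layer with two or more vertices falls strictly short of the
  bound, so equality forces a singleton. With only one vertex left the layer would be the last one
  and carry no information, hence the size at least 2.\<close>

lemma excess_eqD:
  assumes "card (K \<inter> beyond t) \<le> Suc k" "2 \<le> card (beyond t)"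
    and "excess t = max_trans (Suc k) (Suc (card (beyond t)))"
  obtains c where "layer (Suc t) = {c}" "c \<in> K" "card (beyond t) = Suc (card (beyond (Suc t)))"
    "card (K \<inter> beyond (Suc t)) \<le> k" "excess (Suc t) = max_trans k (Suc (card (beyond (Suc t))))"
proof -
  have ne: "beyond t \<noteq> {}" using assms(2) by (metis card.empty not_numeral_le_zero)
  obtain m where m: "card (beyond t) = Suc (Suc m)" using le_Suc_ex[OF assms(2)] by auto
  have strict: "Suc (Suc m) + max_trans (Suc k) (Suc m) < max_trans (Suc k) (Suc (Suc (Suc m)))"
    using max_trans_Suc_Suc[of k m] by simp
  show thesis
    using ne
  proof (cases rule: layer_cases)
    case 1
    then show thesis using strict assms(3) m by simp
  next
    case 2
    have m2: "card (beyond (Suc t)) + 2 \<le> card (beyond t)"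
      using card_layers[OF fin, where t = t and f = f] 2(2) by simp
    have "card (K \<inter> beyond (Suc t)) \<le> card (K \<inter> beyond t)"
      by (intro card_mono) (use fin in auto)
    then have "excess (Suc t) \<le> max_trans (Suc k) (Suc (card (beyond (Suc t))))"
      using assms(1) by (intro excess_bound) simp
    also have "\<dots> \<le> max_trans (Suc k) (Suc m)" using m m2 by (intro max_trans_mono) simp
    finally show thesis
      using sum_layers[OF fin, where t = t and f = f] strict assms(3) m by simp
  next
    case (3 c)
    then show thesis using that[of c] sum_layers[OF fin, where t = t and f = f] assms(1,3) by simp
  qed
qed

text \<open>Without cut vertices a singleton layer cannot precede another one, and three or more
  vertices lose to two because \<open>qsq\<close> increases strictly from 1 on.\<close>

lemma excess_eq_two:
  assumes "K \<inter> beyond t = {}" "2 \<le> card (beyond t)" "excess t = qsq (Suc (card (beyond t)))"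
  shows "card (layer (Suc t)) = 2"
proof -
  have ne: "beyond t \<noteq> {}" using assms(2) by (metis card.empty not_numeral_le_zero)
  obtain m where m: "card (beyond t) = Suc (Suc m)" using le_Suc_ex[OF assms(2)] by auto
  have q: "qsq (Suc (card (beyond t))) = qsq (Suc m) + Suc (Suc m)" unfolding m by (rule qsq_Suc_Suc)
  show ?thesis
    using ne
  proof (cases rule: layer_cases)
    case 1
    then have "qsq (Suc m) = 0" using q assms(3) m by simp
    then have "m = 0" using qsq_less_Suc[of m] by (cases m) auto
    then show ?thesis using 1 m by simp
  next
    case 2
    show ?thesis
    proof (rule ccontr)
      assume "card (layer (Suc t)) \<noteq> 2"
      then have a: "card (beyond (Suc t)) + 3 \<le> card (beyond t)"
        using card_layers[OF fin, where t = t and f = f] 2(2) by simp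
      have "excess (Suc t) \<le> max_trans 0 (Suc (card (beyond (Suc t))))"
        by (rule excess_bound) (use assms(1) in \<open>auto simp: card_eq_0_iff\<close>)
      also have "\<dots> \<le> max_trans 0 m" using m a by (intro max_trans_mono) simp
      finally have "excess t \<le> Suc (Suc m) + qsq m" using sum_layers[OF fin, where t = t and f = f] m by simp
      moreover have "qsq m < qsq (Suc m)" using a m by (intro qsq_less_Suc) simp
      ultimately show False using q assms(3) by simp
    qed
  next
    case (3 c)
    then show ?thesis using assms(1) by auto
  qed
qed

end

section \<open>From distance layers to bounds for transmissions and Wiener indices\<close>

context ugraph begin

text \<open>Distances change by at most one along an arc. So after deleting the only vertex of a
  layer the vertices nearer to the root form a closed set, which everything beyond is cut off
  from.\<close>

lemma sdist_layering:
  assumes "finite U" "conn E U" "v \<in> U"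
  shows "layering U (sdist E U v) {x. is_cut E U x}"
proof
  show "finite U" by fact
next
  fix t assume "{u \<in> U. t < sdist E U v u} \<noteq> {}"
  then obtain x where x: "x \<in> U" "t < sdist E U v x" by auto
  then have "\<exists>u\<in>U. sdist E U v u = Suc t"
  proof (induction "sdist E U v x" arbitrary: x rule: less_induct)
    case less
    show ?case
    proof (cases "sdist E U v x = Suc t")
      case False
      have "x \<noteq> v" using less.prems by auto
      then obtain y where "y \<in> U" "sdist E U v x = Suc (sdist E U v y)"
        using descending_sdist[OF assms(2,3)] less.prems unfolding descending_def by blast
      then show ?thesis using less.hyps[of y] less.prems False by simp
    qed (use less in blast)
  qed
  then show "{u \<in> U. sdist E U v u = Suc t} \<noteq> {}" by blast
next
  fix t c assume c: "{u \<in> U. sdist E U v u = Suc t} = {c}" and ne: "{u \<in> U. Suc t < sdist E U v u} \<noteq> {}"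
  have cU: "c \<in> U" "sdist E U v c = Suc t" using c by auto
  then have vc: "v \<noteq> c" by auto
  have "\<not> conn E (U - {c})"
  proof
    assume conn: "conn E (U - {c})"
    have "{u \<in> U. sdist E U v u < Suc t} = U - {c}"
    proof (rule connD[OF conn])
      show "{u \<in> U. sdist E U v u < Suc t} \<subseteq> U - {c}" using cU by auto
      have "v \<in> {u \<in> U. sdist E U v u < Suc t}" using assms(3) by simp
      then show "{u \<in> U. sdist E U v u < Suc t} \<noteq> {}" by blast
      fix x y assume xy: "x \<in> {u \<in> U. sdist E U v u < Suc t}" "y \<in> U - {c}" "(x, y) \<in> E"
      then have "sdist E U v y \<le> Suc (sdist E U v x)"
        using lip_sdist[OF assms(2,3)] unfolding lip_def by blast
      moreover have "sdist E U v y \<noteq> Suc t" using c xy(2) by blast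
      ultimately show "y \<in> {u \<in> U. sdist E U v u < Suc t}" using xy by simp
    qed
    moreover obtain w where "w \<in> U" "Suc t < sdist E U v w" using ne by blast
    ultimately have "w \<in> U - {c} \<longleftrightarrow> w \<in> {u \<in> U. sdist E U v u < Suc t}" by simp
    then show False using \<open>w \<in> U\<close> \<open>Suc t < sdist E U v w\<close> cU by auto
  qed
  then show "c \<in> {x. is_cut E U x}" using cU vc assms(3) unfolding is_cut_def by blast
qed

lemma transmission_excess:
  assumes "finite U"
  shows "transmission E U v = (\<Sum>u | u \<in> U \<and> 0 < sdist E U v u. sdist E U v u - 0)"
  unfolding transmission_def by (rule sum.mono_neutral_cong_right) (use assms in auto)

lemma sdist_pos_set:
  assumes "conn E U" "v \<in> U"
  shows "{u \<in> U. 0 < sdist E U v u} = U - {v}"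
  using sdist_eq_0_iff[OF assms] by auto

lemma card_beyond_0:
  assumes "finite U" "conn E U" "v \<in> U"
  shows "Suc (card {u \<in> U. 0 < sdist E U v u}) = card U"
  unfolding sdist_pos_set[OF assms(2,3)] using assms card.remove[of U v] by simp

text \<open>The root sits in layer 0 and is never charged, so only the other cut vertices
  count.\<close>

lemma transmission_le:
  assumes "finite U" "conn E U" "v \<in> U" "card ({x. is_cut E U x} - {v}) \<le> k"
  shows "transmission E U v \<le> max_trans k (card U)"
proof -
  interpret layering U "sdist E U v" "{x. is_cut E U x}" by (rule sdist_layering[OF assms(1-3)])
  have "{x. is_cut E U x} \<inter> {u \<in> U. 0 < sdist E U v u} = {x. is_cut E U x} - {v}"
    unfolding sdist_pos_set[OF assms(2,3)] by (auto simp: is_cut_def)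
  then have "card ({x. is_cut E U x} \<inter> {u \<in> U. 0 < sdist E U v u}) \<le> k" using assms(4) by simp
  from excess_bound[OF this] show ?thesis
    unfolding transmission_excess[OF assms(1)] card_beyond_0[OF assms(1-3)] .
qed

lemma wiener2_le_no_cut:
  assumes "finite U" "conn E U" "{x. is_cut E U x} = {}"
  shows "wiener2 E U \<le> card U * qsq (card U)"
proof -
  have "wiener2 E U \<le> (\<Sum>v\<in>U. qsq (card U))"
    unfolding wiener2_def using transmission_le[OF assms(1,2), of _ 0] assms(3) by (intro sum_mono) simp
  then show ?thesis by simp
qed

lemma split_at_card:
  assumes "split_at E V A B c" "finite V"
  shows "card A + card B = Suc (card V)"
  using assms card_Un_Int[of A B] unfolding split_at_def by auto

lemma finite_cuts: "finite U \<Longrightarrow> finite {x. is_cut E U x}"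
  by (rule finite_subset[of _ U]) (auto simp: is_cut_def)

lemma two_le_card: "finite U \<Longrightarrow> x \<in> U \<Longrightarrow> y \<in> U \<Longrightarrow> x \<noteq> y \<Longrightarrow> 2 \<le> card U"
  using card_mono[of U "{x, y}"] by simp

text \<open>\<open>g\<close> counts the vertices on the far side of \<open>c\<close>. In the
  induction, splitting a piece \<open>A\<close> off \<open>B\<close> at \<open>c\<close> moves its
  \<open>card A - 1\<close> other vertices to the far side of the rest. At \<open>g = 0\<close> the
  bound fails for the star on four vertices with centre \<open>c\<close>. The last summand on the
  left is the strict gap that later excludes a cut vertex from a large \<open>B\<close>.\<close>

lemma end_bound:
  assumes "finite B" "conn E B" "c \<in> B" "{x. is_cut E B x} \<subseteq> {c}" "1 \<le> g" "2 \<le> card B"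
  shows "wiener2 E B + 2 * g * transmission E B c + (if is_cut E B c \<and> 6 \<le> card B then 1 else 0)
    \<le> (card B + 2 * g) * qsq (card B) + (if card B = 3 then 2 else 0)"
  using assms
proof (induction "card B" arbitrary: B g rule: less_induct)
  case less
  show ?case
  proof (cases "is_cut E B c")
    case False
    then have no: "{x. is_cut E B x} = {}" using less.prems(4) by blast
    have "transmission E B c \<le> qsq (card B)"
      using transmission_le[OF less.prems(1-3), of 0] no by simp
    then have "2 * g * transmission E B c \<le> 2 * g * qsq (card B)" by simp
    then have "wiener2 E B + 2 * g * transmission E B c \<le> (card B + 2 * g) * qsq (card B)"
      unfolding distrib_right by (intro add_mono wiener2_le_no_cut[OF less.prems(1,2) no])
    then show ?thesis using False by simp
  next
    case True
    have "B \<noteq> {c}" using True unfolding is_cut_def by blast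
    then obtain r where r: "r \<in> B" "r \<noteq> c" using less.prems(3) by blast
    obtain c' A B' where sp: "split_at E B A B' c'" "is_cut E B c'" "r \<in> A" "r \<noteq> c'" "B' \<noteq> {c'}"
      and cuts: "{x. is_cut E A x} = {x. is_cut E B x} - {c'}" "{x. is_cut E B' x} \<subseteq> {c'}"
      using extremal_split[OF less.prems(1,2) r True] by metis
    have c': "c' = c" using sp(2) less.prems(4) by blast
    note sp = sp[unfolded c'] note cuts = cuts[unfolded c']
    have conn: "conn E A" "conn E B'" using split_at_conn_iff[OF sp(1)] less.prems(2) by blast+
    have sub: "A \<subseteq> B" "B' \<subseteq> B" "c \<in> A" "c \<in> B'" using sp(1) unfolding split_at_def by blast+
    have fin: "finite A" "finite B'" using sub(1,2) less.prems(1) finite_subset by blast+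
    have a2: "2 \<le> card A" using two_le_card[OF fin(1) sp(3) sub(3) sp(4)] .
    obtain y where "y \<in> B'" "y \<noteq> c" using sub(4) sp(5) by blast
    then have b2: "2 \<le> card B'" using two_le_card[OF fin(2) _ sub(4)] by blast
    have card: "card A + card B' - 1 = card B" using split_at_card[OF sp(1) less.prems(1)] by simp
    have noA: "{x. is_cut E A x} = {}" using cuts(1) less.prems(4) by blast
    have A: "wiener2 E A \<le> card A * qsq (card A)" "transmission E A c \<le> qsq (card A)"
      using wiener2_le_no_cut[OF fin(1) conn(1) noA] transmission_le[OF fin(1) conn(1) sub(3), of 0] noA
      by simp_all
    have IH: "wiener2 E B' + 2 * (card A - 1 + g) * transmission E B' c
      \<le> (card B' + 2 * (card A - 1 + g)) * qsq (card B') + (if card B' = 3 then 2 else 0)"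
    proof -
      have "card B' < card B" "1 \<le> card A - 1 + g" using card a2 less.prems(5) by auto
      from less.hyps[OF this(1) fin(2) conn(2) sub(4) cuts(2) this(2) b2] show ?thesis by linarith
    qed
    have "transmission E B c = transmission E A c + transmission E B' c"
      using split_at_transmission[OF sp(1) less.prems(2,1) sub(3)] by simp
    then have "wiener2 E B + 2 * g * transmission E B c
      = wiener2 E A + 2 * (card B' - 1 + g) * transmission E A c
        + (wiener2 E B' + 2 * (card A - 1 + g) * transmission E B' c)"
      unfolding split_at_wiener2[OF sp(1) less.prems(2,1)]
      by (simp only: distrib_left distrib_right)
    also have "\<dots> \<le> card A * qsq (card A) + 2 * (card B' - 1 + g) * qsq (card A)
      + ((card B' + 2 * (card A - 1 + g)) * qsq (card B') + (if card B' = 3 then 2 else 0))"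
      using A(1) mult_left_mono[OF A(2), of "2 * (card B' - 1 + g)"] IH by linarith
    also have "\<dots> = (card A + 2 * (card B' - 1 + g)) * qsq (card A)
      + (card B' + 2 * (card A - 1 + g)) * qsq (card B') + (if card B' = 3 then 2 else 0)"
      by (simp only: distrib_right add.assoc)
    finally have "wiener2 E B + 2 * g * transmission E B c \<le> \<dots>" .
    then show ?thesis
      using glue_step[OF a2 b2 less.prems(5)] True unfolding card by simp
  qed
qed

lemma exists_not_cut:
  assumes "finite V" "conn E V" "2 \<le> card V"
  obtains r where "r \<in> V" "\<not> is_cut E V r"
proof -
  obtain v where v: "v \<in> V" using assms(2) unfolding conn_def by blast
  define m where "m = Max (sdist E V v ` V)"
  have "m \<in> sdist E V v ` V" unfolding m_def using assms(1) v by (intro Max_in) auto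
  then obtain x where x: "x \<in> V" "sdist E V v x = m" by auto
  have far: "sdist E V v y \<le> sdist E V v x" if "y \<in> V" for y
    unfolding x(2) m_def using assms(1) that by (intro Max_ge) auto
  have "x \<noteq> v"
  proof
    assume "x = v"
    then have "V \<subseteq> {v}" using far sdist_eq_0_iff[OF assms(2) v] by auto
    then have "card V \<le> 1" using card_mono[of "{v}" V] by simp
    then show False using assms(3) by simp
  qed
  then show thesis using that[OF x(1)] farthest_not_cut[OF assms(2) v x(1) _ far] by blast
qed

text \<open>As \<open>r\<close> is not a cut vertex, \<open>A\<close> contains it besides
  \<open>c\<close> and the \<open>k\<close> remaining cut vertices; hence \<open>k + 2\<close> as
  lower bound for its size. The final estimate keeps \<open>wiener2 E A\<close>, which is bounded
  recursively.\<close>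

lemma end_split:
  assumes "finite V" "conn E V" "card {x. is_cut E V x} = Suc k" "r \<in> V" "\<not> is_cut E V r"
  obtains c A B where "split_at E V A B c" "is_cut E V c" "r \<in> A" "r \<noteq> c"
    "conn E A" "conn E B" "finite A" "finite B" "c \<in> A" "c \<in> B"
    "{x. is_cut E A x} = {x. is_cut E V x} - {c}" "card {x. is_cut E A x} = k"
    "{x. is_cut E B x} \<subseteq> {c}" "\<And>x. is_cut E V x \<Longrightarrow> sdist E V r x \<le> sdist E V r c"
    "conn E (A - {c})" "k + 2 \<le> card A" "2 \<le> card B" "card A + card B = Suc (card V)"
    "transmission E A c \<le> max_trans k (card A)"
    "wiener2 E V + (if is_cut E B c \<and> 6 \<le> card B then 1 else 0)
      \<le> wiener2 E A + (card B + 2 * (card A - 1)) * qsq (card B) + (if card B = 3 then 2 else 0)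
        + 2 * (card B - 1) * transmission E A c"
proof -
  have fC: "finite {x. is_cut E V x}" by (rule finite_cuts[OF assms(1)])
  obtain c0 where c0: "is_cut E V c0" using assms(3) by (metis Collect_empty_eq card.empty nat.distinct(1))
  have "r \<noteq> c0" using c0 assms(5) by blast
  from extremal_split[OF assms(1,2,4) this c0] obtain c A B where
    sp: "split_at E V A B c" "is_cut E V c" "r \<in> A" "r \<noteq> c" "B \<noteq> {c}"
    and cuts: "{x. is_cut E A x} = {x. is_cut E V x} - {c}" "{x. is_cut E B x} \<subseteq> {c}"
    and far: "\<And>x. is_cut E V x \<Longrightarrow> sdist E V r x \<le> sdist E V r c" and Ac: "conn E (A - {c})" by metis
  have conn: "conn E A" "conn E B" using split_at_conn_iff[OF sp(1)] assms(2) by blast+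
  have sub: "A \<subseteq> V" "B \<subseteq> V" "c \<in> A" "c \<in> B" using sp(1) unfolding split_at_def by blast+
  have fin: "finite A" "finite B" using sub(1,2) assms(1) finite_subset by blast+
  have k: "card {x. is_cut E A x} = k" unfolding cuts(1) using fC assms(3) sp(2) by simp
  have "insert r (insert c {x. is_cut E A x}) \<subseteq> A" using sp(3) sub(3) unfolding is_cut_def by blast
  moreover have "card (insert r (insert c {x. is_cut E A x})) = k + 2"
  proof -
    have "finite {x. is_cut E A x}" "c \<notin> {x. is_cut E A x}" "r \<notin> {x. is_cut E A x}"
      using cuts(1) fC assms(5) by auto
    then show ?thesis using k sp(4) by simp
  qed
  ultimately have a2: "k + 2 \<le> card A" using card_mono[OF fin(1)] by metis
  obtain y where "y \<in> B" "y \<noteq> c" using sub(4) sp(5) by blast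
  then have b2: "2 \<le> card B" using two_le_card[OF fin(2) _ sub(4)] by blast
  have DA: "transmission E A c \<le> max_trans k (card A)"
    by (rule transmission_le[OF fin(1) conn(1) sub(3)]) (use k cuts(1) in simp)
  have "wiener2 E B + 2 * (card A - 1) * transmission E B c + (if is_cut E B c \<and> 6 \<le> card B then 1 else 0)
    \<le> (card B + 2 * (card A - 1)) * qsq (card B) + (if card B = 3 then 2 else 0)"
    using a2 by (intro end_bound fin conn sub cuts b2) simp
  then have W: "wiener2 E V + (if is_cut E B c \<and> 6 \<le> card B then 1 else 0)
      \<le> wiener2 E A + (card B + 2 * (card A - 1)) * qsq (card B) + (if card B = 3 then 2 else 0)
        + 2 * (card B - 1) * transmission E A c"
    unfolding split_at_wiener2[OF sp(1) assms(2,1)] by linarith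
  show thesis
    by (rule that[OF sp(1-4) conn fin sub(3,4) cuts(1) k cuts(2) far Ac a2 b2
        split_at_card[OF sp(1) assms(1)] DA W])
qed

lemma wiener2_le_1:
  assumes "finite V" "conn E V" "card {x. is_cut E V x} = 1"
  shows "wiener2 E V \<le> wbound1 (card V)"
proof -
  have k: "card {x. is_cut E V x} = Suc 0" using assms(3) by simp
  then obtain c where c: "{x. is_cut E V x} = {c}" by (auto simp: card_Suc_eq)
  then have "V \<noteq> {c}" "c \<in> V" unfolding is_cut_def by auto
  then obtain r where r: "r \<in> V" "\<not> is_cut E V r" using c by blast
  obtain c A B where *: "finite A" "conn E A" "card {x. is_cut E A x} = 0" "0 + 2 \<le> card A" "2 \<le> card B"
    "card A + card B = Suc (card V)" "transmission E A c \<le> max_trans 0 (card A)"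
    "wiener2 E V + (if is_cut E B c \<and> 6 \<le> card B then 1 else 0)
      \<le> wiener2 E A + (card B + 2 * (card A - 1)) * qsq (card B) + (if card B = 3 then 2 else 0)
        + 2 * (card B - 1) * transmission E A c"
    using end_split[OF assms(1,2) k r] by metis
  have "wiener2 E A \<le> card A * qsq (card A)"
    using wiener2_le_no_cut[OF *(1,2)] *(3) finite_cuts[OF *(1)] by simp
  moreover have "2 * (card B - 1) * transmission E A c \<le> 2 * (card B - 1) * qsq (card A)"
    using *(7) by (intro mult_left_mono) auto
  moreover have cV: "card V = card B + card A - 1" using *(6) by simp
  moreover have "2 \<le> card A" using *(4) by simp
  ultimately show ?thesis unfolding cV using *(8) wbound1_step[OF *(5), of "card A"] by linarith
qed

lemma wiener2_le_2:
  assumes "finite V" "conn E V" "card {x. is_cut E V x} = 2"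
  shows "wiener2 E V \<le> wbound2 (card V)"
proof -
  have k: "card {x. is_cut E V x} = Suc 1" using assms(3) by simp
  have "card {x. is_cut E V x} \<le> card V" by (intro card_mono assms(1)) (auto simp: is_cut_def)
  then obtain r where r: "r \<in> V" "\<not> is_cut E V r" using exists_not_cut[OF assms(1,2)] assms(3) by auto
  obtain c A B where *: "finite A" "conn E A" "card {x. is_cut E A x} = 1" "1 + 2 \<le> card A" "2 \<le> card B"
    "card A + card B = Suc (card V)" "transmission E A c \<le> max_trans 1 (card A)"
    "wiener2 E V + (if is_cut E B c \<and> 6 \<le> card B then 1 else 0)
      \<le> wiener2 E A + (card B + 2 * (card A - 1)) * qsq (card B) + (if card B = 3 then 2 else 0)
        + 2 * (card B - 1) * transmission E A c"
    using end_split[OF assms(1,2) k r] by metis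
  have "wiener2 E A \<le> wbound1 (card A)" by (rule wiener2_le_1[OF *(1-3)])
  moreover have "2 * (card B - 1) * transmission E A c \<le> 2 * (card B - 1) * max_trans 1 (card A)"
    using *(7) by (intro mult_left_mono) auto
  moreover have cV: "card V = card B + card A - 1" using *(6) by simp
  moreover have "3 \<le> card A" using *(4) by simp
  ultimately show ?thesis unfolding cV using *(8) wbound2_step[OF *(5), of "card A"] by linarith
qed

end

section \<open>Extremal graphs\<close>


context ugraph begin

text \<open>The root is a parameter because the equality analysis uses the splitting for two
  different roots. The equality clauses read the chain of estimates backwards: no slack may remain
  in \<open>wbound3_step\<close>, in the transmission of \<open>c\<close> or in
  \<open>end_bound\<close>.\<close>

lemma wiener2_le_3_split:
  assumes "finite V" "conn E V" "card {x. is_cut E V x} = 3" "14 \<le> card V" "r \<in> V" "\<not> is_cut E V r"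
  obtains c A B where "split_at E V A B c" "is_cut E V c" "r \<in> A" "r \<noteq> c"
    "conn E A" "conn E B" "finite A" "finite B" "c \<in> A" "c \<in> B"
    "card {x. is_cut E A x} = 2" "{x. is_cut E B x} \<subseteq> {c}"
    "\<And>x. is_cut E V x \<Longrightarrow> sdist E V r x \<le> sdist E V r c"
    "conn E (A - {c})" "4 \<le> card A" "2 \<le> card B" "card A + card B = Suc (card V)"
    "wiener2 E V \<le> wbound3 (card V)"
    "wiener2 E V = wbound3 (card V) \<Longrightarrow> card B = 2 \<or> card A = 4"
    "wiener2 E V = wbound3 (card V) \<Longrightarrow> transmission E A c = max_trans 2 (card A)"
    "wiener2 E V = wbound3 (card V) \<Longrightarrow> card A = 4 \<Longrightarrow>
      {x. is_cut E B x} = {} \<and> wiener2 E B = card B * qsq (card B)"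
proof -
  have k: "card {x. is_cut E V x} = Suc 2" using assms(3) by simp
  obtain c A B where sp: "split_at E V A B c" "is_cut E V c" "r \<in> A" "r \<noteq> c"
    "conn E A" "conn E B" "finite A" "finite B" "c \<in> A" "c \<in> B"
    and cuts: "card {x. is_cut E A x} = 2" "{x. is_cut E B x} \<subseteq> {c}"
    and far: "\<And>x. is_cut E V x \<Longrightarrow> sdist E V r x \<le> sdist E V r c"
    and Ac: "conn E (A - {c})" "2 + 2 \<le> card A" "2 \<le> card B" "card A + card B = Suc (card V)"
    and D: "transmission E A c \<le> max_trans 2 (card A)"
    and W: "wiener2 E V + (if is_cut E B c \<and> 6 \<le> card B then 1 else 0)
      \<le> wiener2 E A + (card B + 2 * (card A - 1)) * qsq (card B) + (if card B = 3 then 2 else 0)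
        + 2 * (card B - 1) * transmission E A c"
    using end_split[OF assms(1,2) k assms(5,6)] by metis
  have a4: "4 \<le> card A" and cV: "card V = card B + card A - 1" using Ac(2,4) by simp_all
  have WA: "wiener2 E A \<le> wbound2 (card A)" by (rule wiener2_le_2[OF sp(7,5) cuts(1)])
  have DA: "2 * (card B - 1) * transmission E A c \<le> 2 * (card B - 1) * max_trans 2 (card A)"
    using D by (intro mult_left_mono) auto
  have N: "(card B + 2 * (card A - 1)) * qsq (card B) + (if card B = 3 then 2 else 0)
      + 2 * (card B - 1) * max_trans 2 (card A) + wbound2 (card A)
      + (if card B = 2 \<or> card A = 4 then 0 else 1) \<le> wbound3 (card V)"
    unfolding cV using Ac(4) assms(4) by (intro wbound3_step Ac(3) a4) simp
  have le: "wiener2 E V \<le> wbound3 (card V)" using WA DA N W by linarith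
  have eq1: "card B = 2 \<or> card A = 4" if "wiener2 E V = wbound3 (card V)"
  proof (rule ccontr)
    assume "\<not> ?thesis"
    then have "(if card B = 2 \<or> card A = 4 then 0 else 1) = (1 :: nat)" by simp
    then show False using WA DA N W that by linarith
  qed
  have eq2: "transmission E A c = max_trans 2 (card A)" if "wiener2 E V = wbound3 (card V)"
  proof -
    have "2 * (card B - 1) * transmission E A c = 2 * (card B - 1) * max_trans 2 (card A)"
      using WA DA N W that by linarith
    then show ?thesis using Ac(3) by simp
  qed
  have eq3: "{x. is_cut E B x} = {} \<and> wiener2 E B = card B * qsq (card B)"
    if *: "wiener2 E V = wbound3 (card V)" "card A = 4"
  proof -
    \<comment> \<open>In fact \<open>card B\<close> is at least 11, so the strict gap of
      \<open>end_bound\<close> applies and its correction at size 3 does not.\<close>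
    have b: "6 \<le> card B" "card B \<noteq> 3" using Ac(4) that(2) assms(4) by simp_all
    have "\<not> is_cut E B c"
    proof
      assume "is_cut E B c"
      then have "(if is_cut E B c \<and> 6 \<le> card B then 1 else 0) = (1 :: nat)" using b by simp
      then show False using WA DA N W that by linarith
    qed
    then have none: "{x. is_cut E B x} = {}" using cuts(2) by blast
    have "wiener2 E B \<le> card B * qsq (card B)" by (rule wiener2_le_no_cut[OF sp(8,6) none])
    moreover have "2 * (card A - 1) * transmission E B c \<le> 2 * (card A - 1) * qsq (card B)"
      using transmission_le[OF sp(8,6,10), of 0] none by (intro mult_left_mono) simp_all
    moreover have "(if card B = 3 then 2 else 0) = (0 :: nat)" using b by simp
    ultimately have "wiener2 E B = card B * qsq (card B)"
      using WA DA N that(1) split_at_wiener2[OF sp(1) assms(2,1)]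
      unfolding distrib_right[of "card B"] by linarith
    then show ?thesis using none by blast
  qed
  show thesis
    by (rule that[OF sp cuts far Ac(1) a4 Ac(3,4) le eq1 eq2 eq3])
qed

text \<open>A vertex of maximal transmission sees three singleton layers first; cutting at the last of them
  leaves exactly four vertices on its side.\<close>

lemma extremal_structure:
  assumes "finite V" "conn E V" "card {x. is_cut E V x} = 3" "14 \<le> card V"
    and "wiener2 E V = wbound3 (card V)"
  obtains c A B where "split_at E V A B c" "conn E A" "conn E B" "finite A" "finite B"
    "card {x. is_cut E A x} = 2" "card A = 4" "transmission E A c = 6"
    "{x. is_cut E B x} = {}" "wiener2 E B = card B * qsq (card B)"
proof -
  note result = that
  have "2 \<le> card V" using assms(4) by simp
  then obtain r where r: "r \<in> V" "\<not> is_cut E V r" using exists_not_cut[OF assms(1,2)] by blast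
  have m6: "max_trans 2 4 = 6" by (simp add: max_trans_2)
  have four: thesis if "split_at E V A B c" "conn E A" "conn E B" "finite A" "finite B"
    "card {x. is_cut E A x} = 2" "card A = 4"
    "transmission E A c = max_trans 2 (card A)"
    "{x. is_cut E B x} = {} \<and> wiener2 E B = card B * qsq (card B)" for c A B
    by (rule result[OF that(1-7) _ conjunct1[OF that(9)] conjunct2[OF that(9)]]) (use that(7,8) m6 in simp)
  obtain c A B where sp: "split_at E V A B c" "conn E A" "conn E B" "finite A" "finite B"
      "c \<in> A" "c \<in> B" "card {x. is_cut E A x} = 2" and cB: "{x. is_cut E B x} \<subseteq> {c}" "2 \<le> card B"
    and card: "card A + card B = Suc (card V)"
    and b: "card B = 2 \<or> card A = 4" and DA: "transmission E A c = max_trans 2 (card A)"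
    and eq4: "card A = 4 \<Longrightarrow> {x. is_cut E B x} = {} \<and> wiener2 E B = card B * qsq (card B)"
    using wiener2_le_3_split[OF assms(1-4) r] assms(5) by metis
  show thesis
  proof (cases "card A = 4")
    case True
    then show thesis using four[OF sp(1-5,8) _ DA] eq4 by blast
  next
    case False
    then have b2: "card B = 2" using b by blast
    have "B \<noteq> {c}" using b2 by auto
    then obtain p where p: "p \<in> B" "p \<noteq> c" using sp(7) by blast
    have V: "V = A \<union> B" using sp(1) unfolding split_at_def by blast
    have pV: "p \<in> V" using p V by blast
    have pnc: "\<not> is_cut E V p"
      using split_at_is_cut_iff[OF split_at_commute[OF sp(1)] assms(2) p] cB(1) p(2) by blast
    have pc: "1 \<le> sdist E B p c" using sdist_eq_0_iff[OF sp(3) p(1) sp(7)] p(2) by (cases "sdist E B p c") auto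
    then have "1 \<le> transmission E B p"
      unfolding transmission_def using member_le_sum[OF sp(7), of "sdist E B p"] sp(5) by simp
    moreover have "(card A - 1) * 1 \<le> (card A - 1) * sdist E B p c" using pc by (intro mult_left_mono) auto
    \<comment> \<open>The left side equals \<open>max_trans 3 (card V)\<close>, so the pendant
      vertex \<open>p\<close> has the largest possible transmission.\<close>
    ultimately have "1 + (card A - 1) + max_trans 2 (card A) \<le> transmission E V p"
      unfolding split_at_transmission[OF split_at_commute[OF sp(1)] assms(2,1) p(1)] DA by linarith
    moreover have "transmission E V p \<le> max_trans 3 (card V)"
      by (rule transmission_le[OF assms(1,2) pV])
        (use assms(3) card_mono[OF finite_cuts[OF assms(1)], of "{x. is_cut E V x} - {p}"] in auto)
    moreover have cA: "card V = Suc (card A)" "1 \<le> card A" using card b2 assms(4) by simp_all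
    moreover have "max_trans 3 (card V) = max_trans 2 (card A) + card A"
      unfolding cA(1) by (simp add: numeral_3_eq_3 numeral_2_eq_2)
    ultimately have Dp: "transmission E V p = max_trans 3 (card V)" by linarith
    interpret layering V "sdist E V p" "{x. is_cut E V x}" by (rule sdist_layering[OF assms(1,2) pV])
    have cb: "Suc (card (beyond 0)) = card V" by (rule card_beyond_0[OF assms(1,2) pV])
    have e0: "excess 0 = max_trans (Suc 2) (Suc (card (beyond 0)))"
    proof -
      have "Suc 2 = (3 :: nat)" by simp
      then show ?thesis unfolding cb transmission_excess[OF assms(1), symmetric] by (simp only: Dp)
    qed
    have k0: "card ({x. is_cut E V x} \<inter> beyond 0) \<le> Suc 2"
      using card_mono[OF finite_cuts[OF assms(1)], of "{x. is_cut E V x} \<inter> beyond 0"] assms(3) by auto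
    have "2 \<le> card (beyond 0)" using cb assms(4) by simp
    \<comment> \<open>With budget 3 and equality throughout, three layers in a row are single cut
      vertices.\<close>
    from excess_eqD[OF k0 this e0] obtain c1 where c1: "layer 1 = {c1}" "is_cut E V c1"
      "card (beyond 0) = Suc (card (beyond 1))"
      "card ({x. is_cut E V x} \<inter> beyond 1) \<le> Suc 1"
      "excess 1 = max_trans (Suc 1) (Suc (card (beyond 1)))" by (auto simp: numeral_2_eq_2)
    have "2 \<le> card (beyond 1)" using cb c1(3) assms(4) by simp
    from excess_eqD[OF c1(4) this c1(5)] obtain c2 where c2: "layer 2 = {c2}" "is_cut E V c2"
      "card (beyond 1) = Suc (card (beyond 2))"
      "card ({x. is_cut E V x} \<inter> beyond 2) \<le> Suc 0"
      "excess 2 = max_trans (Suc 0) (Suc (card (beyond 2)))" by (auto simp: numeral_2_eq_2)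
    have "2 \<le> card (beyond 2)" using cb c1(3) c2(3) assms(4) by simp
    from excess_eqD[OF c2(4) this c2(5)] obtain c3 where c3: "layer 3 = {c3}" "is_cut E V c3"
      by (auto simp: numeral_2_eq_2 numeral_3_eq_3)
    have d: "sdist E V p c1 = 1" "sdist E V p c2 = 2" "sdist E V p c3 = 3" using c1(1) c2(1) c3(1) by auto
    have "{c1, c2, c3} = {x. is_cut E V x}"
    proof (rule card_subset_eq[OF finite_cuts[OF assms(1)]])
      have "c1 \<noteq> c2" "c1 \<noteq> c3" "c2 \<noteq> c3" using d by auto
      then show "card {c1, c2, c3} = card {x. is_cut E V x}" using assms(3) by simp
    qed (use c1 c2 c3 in auto)
    then have K: "x = c1 \<or> x = c2 \<or> x = c3" if "is_cut E V x" for x using that by blast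
    \<comment> \<open>The splitting is repeated with \<open>p\<close> as root. All cut vertices are
      now known, and the farthest from \<open>p\<close> is the one in layer 3.\<close>
    obtain c' A' B' where sp': "split_at E V A' B' c'" "conn E A'" "conn E B'" "finite A'" "finite B'"
        "c' \<in> A'" "card {x. is_cut E A' x} = 2" and c': "is_cut E V c'" "p \<in> A'" "p \<noteq> c'"
        "\<And>x. is_cut E V x \<Longrightarrow> sdist E V p x \<le> sdist E V p c'" "conn E (A' - {c'})" "4 \<le> card A'"
      and DA': "transmission E A' c' = max_trans 2 (card A')"
      and eq4': "card A' = 4 \<Longrightarrow> {x. is_cut E B' x} = {} \<and> wiener2 E B' = card B' * qsq (card B')"
      using wiener2_le_3_split[OF assms(1-4) pV pnc] assms(5) by metis
    have c'3: "c' = c3" using K[OF c'(1)] c'(4)[OF c3(2)] d by auto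
    have A'V: "A' \<subseteq> V" using sp'(1) unfolding split_at_def by blast
    \<comment> \<open>\<open>A' - {c'}\<close> is connected, contains \<open>p\<close> and misses
      the only vertex of layer 3, so it never gets past distance 2.\<close>
    have "{u \<in> A' - {c'}. sdist E V p u < 3} = A' - {c'}"
    proof (rule connD[OF c'(5)])
      have "p \<in> {u \<in> A' - {c'}. sdist E V p u < 3}" using c'(2,3) by simp
      then show "{u \<in> A' - {c'}. sdist E V p u < 3} \<noteq> {}" by blast
      fix x y assume xy: "x \<in> {u \<in> A' - {c'}. sdist E V p u < 3}" "y \<in> A' - {c'}" "(x, y) \<in> E"
      then have "sdist E V p y \<le> Suc (sdist E V p x)"
        using lip_sdist[OF assms(2) pV] A'V unfolding lip_def by blast
      moreover have "sdist E V p y \<noteq> 3" using c3(1) xy(2) A'V c'3 by blast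
      ultimately show "y \<in> {u \<in> A' - {c'}. sdist E V p u < 3}" using xy by simp
    qed blast
    moreover have "{u \<in> A' - {c'}. sdist E V p u < 3} \<subseteq> {p, c1, c2}"
    proof
      fix u assume u: "u \<in> {u \<in> A' - {c'}. sdist E V p u < 3}"
      then have "u \<in> V" "sdist E V p u = 0 \<or> sdist E V p u = 1 \<or> sdist E V p u = 2" using A'V by auto
      then show "u \<in> {p, c1, c2}"
        using sdist_eq_0_iff[OF assms(2) pV] c1(1) c2(1) by blast
    qed
    ultimately have "A' \<subseteq> {p, c1, c2, c'}" by blast
    then have "card A' \<le> card {p, c1, c2, c'}" by (intro card_mono) auto
    also have "\<dots> \<le> 4" by (simp add: card_insert_if)
    finally have "card A' = 4" using c'(6) by simp
    then show thesis using four[OF sp'(1-5,7) _ DA'] eq4' by blast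
  qed
qed

section \<open>Shape of the two sides in the case of equality\<close>

lemma sdist_eq_1_iff:
  assumes "conn E U" "v \<in> U" "u \<in> U"
  shows "sdist E U v u = 1 \<longleftrightarrow> (v, u) \<in> E"
proof
  assume d: "sdist E U v u = 1"
  then have "u \<noteq> v" by auto
  then obtain y where y: "y \<in> U" "(y, u) \<in> E" "sdist E U v u = Suc (sdist E U v y)"
    using descending_sdist[OF assms(1,2)] assms(3) unfolding descending_def by blast
  then have "y = v" using d sdist_eq_0_iff[OF assms(1,2) y(1)] by simp
  then show "(v, u) \<in> E" using y by simp
next
  assume vu: "(v, u) \<in> E"
  then have "sdist E U v u \<le> Suc (sdist E U v v)"
    using lip_sdist[OF assms(1,2)] assms unfolding lip_def by blast
  moreover have "u \<noteq> v" using vu adj_irrefl by blast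
  ultimately show "sdist E U v u = 1" using sdist_eq_0_iff[OF assms] by simp
qed

text \<open>Every transmission is at most \<open>qsq (card B)\<close> and their sum is maximal, so
  each of them is. The first distance layer of \<open>v\<close>, its neighbourhood, then has exactly
  two vertices.\<close>

lemma extremal_two_regular:
  assumes "finite B" "conn E B" "{x. is_cut E B x} = {}" "wiener2 E B = card B * qsq (card B)"
    and "3 \<le> card B" "v \<in> B"
  shows "card {u \<in> B. (v, u) \<in> E} = 2"
proof -
  have le: "transmission E B u \<le> qsq (card B)" if "u \<in> B" for u
    using transmission_le[OF assms(1,2) that, of 0] assms(3) by simp
  have "transmission E B v = qsq (card B)"
  proof (rule ccontr)
    assume "transmission E B v \<noteq> qsq (card B)"
    then have "transmission E B v < qsq (card B)" using le[OF assms(6)] by simp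
    then have "wiener2 E B < (\<Sum>u\<in>B. qsq (card B))"
      unfolding wiener2_def using le assms(1,6) by (intro sum_strict_mono_ex1) auto
    then show False using assms(4) by simp
  qed
  interpret layering B "sdist E B v" "{x. is_cut E B x}" by (rule sdist_layering[OF assms(1,2,6)])
  have cb: "Suc (card (beyond 0)) = card B" by (rule card_beyond_0[OF assms(1,2,6)])
  have "excess 0 = qsq (Suc (card (beyond 0)))"
    unfolding cb transmission_excess[OF assms(1), symmetric] by fact
  moreover have "{x. is_cut E B x} \<inter> beyond 0 = {}" unfolding assms(3) by simp
  moreover have "2 \<le> card (beyond 0)" using cb assms(5) by linarith
  ultimately have "card (layer (Suc 0)) = 2" by (intro excess_eq_two)
  moreover have "layer (Suc 0) = {u \<in> B. (v, u) \<in> E}"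
    using sdist_eq_1_iff[OF assms(2,6)] by auto
  ultimately show ?thesis by simp
qed

text \<open>The transmission 6 = 1 + 2 + 3 is the maximum for four vertices, so all layers around
  \<open>c\<close> are single vertices; an arc cannot skip a layer.\<close>

lemma four_path:
  assumes "finite A" "conn E A" "c \<in> A" "card {x. is_cut E A x} = 2" "card A = 4" "transmission E A c = 6"
  obtains x1 x2 x3 where "A = {c, x1, x2, x3}" "distinct [c, x1, x2, x3]"
    "(c, x1) \<in> E" "(x1, x2) \<in> E" "(x2, x3) \<in> E" "(c, x2) \<notin> E" "(c, x3) \<notin> E" "(x1, x3) \<notin> E"
proof -
  interpret layering A "sdist E A c" "{x. is_cut E A x}" by (rule sdist_layering[OF assms(1-3)])
  have cb: "card (beyond 0) = 3" using card_beyond_0[OF assms(1-3)] assms(5) by simp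
  have e0: "excess 0 = max_trans (Suc 1) (Suc (card (beyond 0)))"
  proof -
    have "max_trans (Suc 1) (Suc 3) = 6" by simp
    then show ?thesis unfolding cb transmission_excess[OF assms(1), symmetric] assms(6) by simp
  qed
  have k0: "card ({x. is_cut E A x} \<inter> beyond 0) \<le> Suc 1"
    using card_mono[OF finite_cuts[OF assms(1)], of "{x. is_cut E A x} \<inter> beyond 0"] assms(4) by auto
  have "2 \<le> card (beyond 0)" using cb by simp
  from excess_eqD[OF k0 this e0] obtain x1 where x1: "layer 1 = {x1}"
    "card (beyond 0) = Suc (card (beyond 1))" "card ({x. is_cut E A x} \<inter> beyond 1) \<le> Suc 0"
    "excess 1 = max_trans (Suc 0) (Suc (card (beyond 1)))" by auto
  have "2 \<le> card (beyond 1)" using cb x1(2) by simp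
  from excess_eqD[OF x1(3) this x1(4)] obtain x2 where x2: "layer 2 = {x2}"
    "card (beyond 1) = Suc (card (beyond 2))" "excess 2 = max_trans 0 (Suc (card (beyond 2)))"
    by (auto simp: numeral_2_eq_2)
  have b2: "card (beyond 2) = 1" using cb x1(2) x2(2) by simp
  then obtain x3 where x3: "beyond 2 = {x3}" by (elim card_1_singletonE)
  have "excess 2 = sdist E A c x3 - 2" unfolding x3 by simp
  moreover have "excess 2 = 1" using x2(3) b2 by (simp add: numeral_2_eq_2[symmetric])
  ultimately have d3: "sdist E A c x3 = 3" by simp
  have d: "sdist E A c x1 = 1" "sdist E A c x2 = 2" and inA: "x1 \<in> A" "x2 \<in> A" "x3 \<in> A"
    using x1(1) x2(1) x3 by auto
  have dist: "distinct [c, x1, x2, x3]" using d d3 by auto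
  have A: "A = {c, x1, x2, x3}"
  proof (rule card_subset_eq[symmetric, OF assms(1)])
    show "card {c, x1, x2, x3} = card A" using dist assms(5) by simp
  qed (use inA assms(3) in auto)
  have desc: "\<exists>y\<in>A. (y, x) \<in> E \<and> sdist E A c x = Suc (sdist E A c y)" if "x \<in> A" "x \<noteq> c" for x
    using descending_sdist[OF assms(2,3)] that unfolding descending_def by blast
  have lip: "sdist E A c y \<le> Suc (sdist E A c x)" if "x \<in> A" "y \<in> A" "(x, y) \<in> E" for x y
    using lip_sdist[OF assms(2,3)] that unfolding lip_def by blast
  have "(c, x1) \<in> E" using sdist_eq_1_iff[OF assms(2,3) inA(1)] d by simp
  moreover have "(x1, x2) \<in> E" using desc[OF inA(2)] dist d d3 unfolding A by auto
  moreover have "(x2, x3) \<in> E" using desc[OF inA(3)] dist d d3 unfolding A by auto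
  moreover have "(c, x2) \<notin> E" "(c, x3) \<notin> E" "(x1, x3) \<notin> E"
    using lip assms(3) inA d d3 by (metis Suc_1 Suc_n_not_le_n sdist_self One_nat_def)
      (use lip[of c x3] lip[of x1 x3] assms(3) inA d d3 in auto)
  ultimately show thesis using that[OF A dist] by blast
qed

end

section \<open>Recognising the lollipop\<close>


context ugraph begin

text \<open>A walk from \<open>c\<close> that always leaves by the other neighbour must first repeat
  at \<open>c\<close>; the vertices visited so far form a closed set, which is all of
  \<open>B\<close>.\<close>

lemma two_regular_cycle:
  assumes fin: "finite B" and conn: "conn E B" and two: "\<And>v. v \<in> B \<Longrightarrow> card {u \<in> B. (v, u) \<in> E} = 2"
    and c: "c \<in> B"
  obtains w :: "nat \<Rightarrow> 'a" where "w 0 = c" "inj_on w {..<card B}" "w ` {..<card B} = B" "3 \<le> card B"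
    "\<And>i k. i < card B \<Longrightarrow> k < card B \<Longrightarrow>
      (w i, w k) \<in> E \<longleftrightarrow> k = Suc i mod card B \<or> i = Suc k mod card B"
proof -
  define N where "N v = {u \<in> B. (v, u) \<in> E}" for v
  have N2: "card (N v) = 2" if "v \<in> B" for v using two[OF that] unfolding N_def .
  have Nsym: "v \<in> N u" if "u \<in> N v" "v \<in> B" for u v using that adj_sym unfolding N_def by blast
  have NB: "u \<in> B" if "u \<in> N v" for u v using that unfolding N_def by blast
  have Nirr: "v \<notin> N v" for v using adj_irrefl unfolding N_def by blast
  have ex: "\<exists>x. x \<in> N v \<and> x \<noteq> u" if "v \<in> B" for u v
  proof (rule ccontr)
    assume "\<not> (\<exists>x. x \<in> N v \<and> x \<noteq> u)"
    then have "N v \<subseteq> {u}" by blast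
    then have "card (N v) \<le> 1" using card_mono[of "{u}" "N v"] by simp
    then show False using N2[OF that] by simp
  qed
  have Neq: "N v = {x, y}" if "v \<in> B" "x \<in> N v" "y \<in> N v" "x \<noteq> y" for v x y
  proof (rule card_subset_eq[symmetric])
    show "finite (N v)" using fin unfolding N_def by simp
  qed (use that N2 in auto)
  define nxt where "nxt u v = (SOME x. x \<in> N v \<and> x \<noteq> u)" for u v
  have nxt: "nxt u v \<in> N v" "nxt u v \<noteq> u" if "v \<in> B" for u v
    using someI_ex[OF ex[OF that, of u]] unfolding nxt_def by blast+
  \<comment> \<open>\<open>s n\<close> holds \<open>w n\<close> and its successor. The start
    \<open>nxt c c\<close> is an arbitrary neighbour of \<open>c\<close>, as \<open>c\<close> is not
    adjacent to itself.\<close>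
  define s where "s n = ((\<lambda>(u, v). (v, nxt u v)) ^^ n) (c, nxt c c)" for n
  define w where "w n = fst (s n)" for n
  have s_Suc: "s (Suc n) = (snd (s n), nxt (fst (s n)) (snd (s n)))" for n
    unfolding s_def by (simp add: case_prod_beta)
  have w0: "w 0 = c" unfolding w_def s_def by simp
  have snd_s: "snd (s n) = w (Suc n)" for n unfolding w_def s_Suc by simp
  have w_Suc_Suc: "w (Suc (Suc n)) = nxt (w n) (w (Suc n))" for n
    unfolding snd_s[symmetric] s_Suc by (simp add: w_def s_Suc)
  have w1: "w 1 = nxt c c" using snd_s[of 0] unfolding s_def by simp
  have wB: "w n \<in> B \<and> w (Suc n) \<in> N (w n)" for n
  proof (induction n)
    case 0
    then show ?case using w0 w1 nxt[OF c] c by simp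
  next
    case (Suc n)
    then have "w (Suc n) \<in> B" using NB by blast
    then show ?case using w_Suc_Suc nxt by simp
  qed
  have w_ne: "w (Suc (Suc n)) \<noteq> w n" for n using w_Suc_Suc nxt(2) wB by metis
  have Nw: "N (w (Suc n)) = {w n, w (Suc (Suc n))}" for n
    using Neq[of "w (Suc n)" "w n" "w (Suc (Suc n))"] wB[of n] wB[of "Suc n"] Nsym w_ne[of n] by metis
  have "\<not> inj_on w UNIV"
  proof
    assume "inj_on w UNIV"
    moreover have "finite (range w)" using fin wB by (meson finite_subset image_subsetI)
    ultimately show False using finite_imageD infinite_UNIV_nat by blast
  qed
  then obtain a b where "a < b" "w a = w b" unfolding inj_on_def by (metis linorder_neqE_nat)
  then have ex_rep: "\<exists>j. \<exists>i<j. w i = w j" by blast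
  define j where "j = (LEAST j. \<exists>i<j. w i = w j)"
  obtain i where i: "i < j" "w i = w j" using LeastI_ex[OF ex_rep] unfolding j_def by blast
  have minimal: "\<not> (\<exists>i<k. w i = w k)" if "k < j" for k using not_less_Least that unfolding j_def by blast
  have inj: "inj_on w {..<j}"
  proof (rule inj_onI)
    fix x y assume xy: "x \<in> {..<j}" "y \<in> {..<j}" "w x = w y"
    show "x = y" using minimal[of x] minimal[of y] xy by (cases x y rule: linorder_cases) auto
  qed
  have wSuc_ne: "w (Suc n) \<noteq> w n" for n using wB[of n] Nirr by metis
  obtain j' where j': "j = Suc j'" using i(1) by (cases j) auto
  have prev_in: "w j' \<in> N (w j)" using wB[of j'] Nsym unfolding j' by blast
  \<comment> \<open>For positive \<open>i\<close> the two neighbours of \<open>w i\<close> are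
    \<open>w (i - 1)\<close> and \<open>w (i + 1)\<close>. The vertex before \<open>w j\<close> is
    one of them, which yields an earlier repetition, a loop or a turn back.\<close>
  have "i = 0"
  proof (rule ccontr)
    assume "i \<noteq> 0"
    then obtain i' where i': "i = Suc i'" by (cases i) auto
    have "w j' \<in> {w i', w (Suc i)}" using prev_in unfolding i(2)[symmetric] i' Nw .
    then consider "w j' = w i'" | "w j' = w (Suc i)" by blast
    then show False
    proof cases
      case 1
      then show False using inj_onD[OF inj 1] i i' j' by simp
    next
      case 2
      show False
      proof (cases "Suc i = j")
        case True
        then show False using 2 wSuc_ne j' by (metis i(2) nat.inject)
      next
        case False
        then have "j' = Suc i" using inj_onD[OF inj 2] i j' by simp
        then show False using w_ne[of i] i(2) j' by simp
      qed
    qed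
  qed
  then have wj: "w j = w 0" using i(2) by simp
  have j3: "3 \<le> j"
  proof -
    have "j \<noteq> 1" using wj wSuc_ne[of 0] by auto
    moreover have "j \<noteq> 2" using wj w_ne[of 0] by (auto simp: numeral_2_eq_2)
    ultimately show ?thesis using i(1) by linarith
  qed
  have N0: "N (w 0) = {w 1, w j'}"
  proof (rule Neq)
    show "w 0 \<in> B" "w 1 \<in> N (w 0)" using wB[of 0] by auto
    show "w j' \<in> N (w 0)" using prev_in wj by simp
    show "w 1 \<noteq> w j'" using inj_onD[OF inj, of 1 j'] j3 j' by auto
  qed
  have im: "w ` {..<j} = B"
  proof (rule connD[OF conn])
    show "w ` {..<j} \<subseteq> B" using wB by blast
    have "w 0 \<in> w ` {..<j}" using j3 by auto
    then show "w ` {..<j} \<noteq> {}" by blast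
    fix x y assume x: "x \<in> w ` {..<j}" and y: "y \<in> B" "(x, y) \<in> E"
    then obtain k where k: "k < j" "x = w k" by blast
    have yN: "y \<in> N (w k)" using y k unfolding N_def by blast
    show "y \<in> w ` {..<j}"
    proof (cases k)
      case 0
      then have "y = w 1 \<or> y = w j'" using yN N0 by auto
      then show ?thesis using j3 j' by auto
    next
      case (Suc k')
      then have "y = w k' \<or> y = w (Suc k)" using yN Nw[of k'] by auto
      moreover have "w (Suc k) \<in> w ` {..<j}"
      proof (cases "Suc k = j")
        case True
        then show ?thesis using wj j3 by auto
      qed (use k in auto)
      ultimately show ?thesis using k Suc by auto
    qed
  qed
  have jB: "card B = j" using card_image[OF inj] im by simp
  have adj: "(w i, w k) \<in> E \<longleftrightarrow> k = Suc i mod j \<or> i = Suc k mod j" if ik: "i < j" "k < j" for i k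
  proof -
    have weq: "w a = w b \<longleftrightarrow> a = b" if "a < j" "b < j" for a b
      using inj_on_eq_iff[OF inj, of a b] that by simp
    have "(w i, w k) \<in> E \<longleftrightarrow> w k \<in> N (w i)" using wB unfolding N_def by simp
    also have "\<dots> \<longleftrightarrow> k = Suc i mod j \<or> i = Suc k mod j"
    proof (cases i)
      case 0
      have "w k \<in> N (w i) \<longleftrightarrow> k = 1 \<or> k = j'"
        unfolding 0 N0 using weq ik j3 j' by auto
      moreover have "Suc k mod j = 0 \<longleftrightarrow> k = j'" using ik(2) j' by (auto simp: mod_Suc)
      moreover have "Suc 0 mod j = 1" using j3 by simp
      ultimately show ?thesis using 0 by auto
    next
      case (Suc i')
      have N: "w k \<in> N (w i) \<longleftrightarrow> k = i' \<or> w k = w (Suc i)"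
        unfolding Suc Nw using weq[of k i'] ik Suc by auto
      have e: "i = Suc k mod j \<longleftrightarrow> k = i'"
        using ik Suc by (cases "Suc k = j") auto
      show ?thesis
      proof (cases "Suc i = j")
        case True
        then have "w k = w (Suc i) \<longleftrightarrow> k = 0" using wj weq[of k 0] ik by auto
        then show ?thesis using N e True by auto
      next
        case False
        then have "w k = w (Suc i) \<longleftrightarrow> k = Suc i" using weq[of k "Suc i"] ik by auto
        then show ?thesis using N e False ik by auto
      qed
    qed
    finally show ?thesis .
  qed
  show thesis by (rule that[of w]) (use w0 inj im j3 adj jB in auto)
qed

end

section \<open>Adjacency in the lollipop and isomorphism as a bijection respecting arcs\<close>

lemma symcl_iff: "(a, b) \<in> symcl R \<longleftrightarrow> (a, b) \<in> R \<or> (b, a) \<in> R"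
  unfolding symcl_def by force

lemma lollipop_adj:
  assumes "3 \<le> g"
  shows "(i, k) \<in> parcs (lollipop (g + 3) g) \<longleftrightarrow>
    (i < g \<and> k < g \<and> (k = Suc i mod g \<or> i = Suc k mod g)) \<or>
    (g - 1 \<le> i \<and> k = Suc i \<and> k < g + 3) \<or> (g - 1 \<le> k \<and> i = Suc k \<and> i < g + 3)"
proof -
  have "Suc i mod g < g" "Suc k mod g < g" using assms by auto
  then show ?thesis unfolding lollipop_def by (auto simp: symcl_iff)
qed

lemma lollipop_adj_high:
  assumes "3 \<le> g" "g \<le> k"
  shows "(i, k) \<in> parcs (lollipop (g + 3) g) \<longleftrightarrow> (k = Suc i \<and> k < g + 3) \<or> (i = Suc k \<and> i < g + 3)"
proof -
  have "\<not> k < g" "k = Suc i \<Longrightarrow> g - 1 \<le> i" "g - 1 \<le> k" using assms by auto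
  then show ?thesis unfolding lollipop_adj[OF assms(1)] by blast
qed

text \<open>Arcs are pairs, so the vertex map determines the arc map, and head and tail remain the
  projections.\<close>

lemma graph_isomorphicI:
  assumes "pair_wf_digraph G" "bij_betw f (pverts G) (pverts H)" "pair_wf_digraph H"
    and "\<And>x y. x \<in> pverts G \<Longrightarrow> y \<in> pverts G \<Longrightarrow> (f x, f y) \<in> parcs H \<longleftrightarrow> (x, y) \<in> parcs G"
  shows "graph_isomorphic G H"
proof -
  interpret G: pair_wf_digraph G by fact
  interpret H: pair_wf_digraph H by fact
  define F where "F = \<lparr>iso_verts = f, iso_arcs = map_prod f f, iso_head = snd, iso_tail = fst\<rparr>"
  have inj: "inj_on f (pverts G)" and im: "f ` pverts G = pverts H"
    using assms(2) unfolding bij_betw_def by auto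
  have "inj_on (map_prod f f) (parcs G)"
    by (rule inj_on_subset[OF map_prod_inj_on[OF inj inj]]) (auto dest: G.in_arcsD1 G.in_arcsD2)
  moreover have "wf_digraph (with_proj G)" unfolding wf_digraph_wp_iff by fact
  ultimately have "pre_digraph.digraph_isomorphism (with_proj G) F"
    unfolding pre_digraph.digraph_isomorphism_def F_def using inj by simp
  moreover have "with_proj H = app_iso F (with_proj G)"
  proof -
    have "map_prod f f ` parcs G = parcs H"
    proof (intro equalityI subsetI)
      fix e assume "e \<in> map_prod f f ` parcs G"
      then show "e \<in> parcs H" using assms(4) G.in_arcsD1 G.in_arcsD2 by auto
    next
      fix e assume e: "e \<in> parcs H"
      obtain a b where ab: "e = (a, b)" by (cases e)
      then have "a \<in> f ` pverts G" "b \<in> f ` pverts G"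
        unfolding im using e H.in_arcsD1 H.in_arcsD2 by auto
      then obtain x y where xy: "x \<in> pverts G" "y \<in> pverts G" "a = f x" "b = f y" by blast
      then have "(x, y) \<in> parcs G" using assms(4) e ab by blast
      then show "e \<in> map_prod f f ` parcs G" using ab xy by force
    qed
    then show ?thesis unfolding F_def app_iso_def with_proj_def using im by simp
  qed
  ultimately show ?thesis unfolding graph_isomorphic_def digraph_iso_def by blast
qed

text \<open>Equality with \<open>with_proj H\<close> forces the head and tail maps of the
  isomorphism to be the projections; on arcs its arc map is then the pair of vertex images.\<close>

lemma graph_isomorphicE:
  assumes "graph_isomorphic G H"
  obtains f where "bij_betw f (pverts G) (pverts H)"
    "\<And>x y. x \<in> pverts G \<Longrightarrow> y \<in> pverts G \<Longrightarrow> (f x, f y) \<in> parcs H \<longleftrightarrow> (x, y) \<in> parcs G"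
proof -
  obtain F where F: "pre_digraph.digraph_isomorphism (with_proj G) F" "with_proj H = app_iso F (with_proj G)"
    using assms unfolding graph_isomorphic_def digraph_iso_def by blast
  have wf: "pair_wf_digraph G" and inj: "inj_on (iso_verts F) (pverts G)"
    and tl: "\<And>a. a \<in> parcs G \<Longrightarrow> iso_verts F (fst a) = iso_tail F (iso_arcs F a)"
    and hd: "\<And>a. a \<in> parcs G \<Longrightarrow> iso_verts F (snd a) = iso_head F (iso_arcs F a)"
    using F(1) unfolding pre_digraph.digraph_isomorphism_def wf_digraph_wp_iff by auto
  interpret G: pair_wf_digraph G by (rule wf)
  have H: "pverts H = iso_verts F ` pverts G" "parcs H = iso_arcs F ` parcs G"
    "fst = iso_tail F" "snd = iso_head F"
    using F(2) unfolding app_iso_def with_proj_def by simp_all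
  have arc: "iso_arcs F a = (iso_verts F (fst a), iso_verts F (snd a))" if "a \<in> parcs G" for a
    using tl[OF that] hd[OF that] unfolding H(3,4)[symmetric] by simp
  show thesis
  proof (rule that)
    show "bij_betw (iso_verts F) (pverts G) (pverts H)" using inj H(1) unfolding bij_betw_def by simp
    fix x y assume xy: "x \<in> pverts G" "y \<in> pverts G"
    show "(iso_verts F x, iso_verts F y) \<in> parcs H \<longleftrightarrow> (x, y) \<in> parcs G"
    proof
      assume "(iso_verts F x, iso_verts F y) \<in> parcs H"
      then obtain a where a: "a \<in> parcs G" "(iso_verts F x, iso_verts F y) = iso_arcs F a" unfolding H(2) by blast
      obtain p q where pq: "a = (p, q)" by (cases a)
      have "p \<in> pverts G" "q \<in> pverts G" using a(1) pq G.in_arcsD1 G.in_arcsD2 by auto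
      moreover have "iso_verts F x = iso_verts F p" "iso_verts F y = iso_verts F q" using a(2) arc[OF a(1)] pq by auto
      ultimately have "x = p" "y = q" using inj xy by (auto dest: inj_onD)
      then show "(x, y) \<in> parcs G" using a(1) pq by simp
    next
      assume "(x, y) \<in> parcs G"
      then show "(iso_verts F x, iso_verts F y) \<in> parcs H" unfolding H(2) using arc[of "(x, y)"] by force
    qed
  qed
qed


text \<open>The reflection sending \<open>i\<close> to \<open>g - 1 - i\<close> exchanges successors
  and predecessors on the cycle, so adjacency is preserved.\<close>

lemma reflect_adj:
  fixes i i' k k' g :: nat
  assumes "Suc (i + i') = g" "Suc (k + k') = g"
  shows "(k' = Suc i' mod g \<or> i' = Suc k' mod g) \<longleftrightarrow> (k = Suc i mod g \<or> i = Suc k mod g)"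
proof -
  have "Suc i' mod g = (if i = 0 then 0 else Suc i')" "Suc k' mod g = (if k = 0 then 0 else Suc k')"
    "Suc i mod g = (if i' = 0 then 0 else Suc i)" "Suc k mod g = (if k' = 0 then 0 else Suc k)"
    using assms by auto
  moreover have "k' = Suc i' \<longleftrightarrow> i = Suc k" "i' = Suc k' \<longleftrightarrow> k = Suc i" "i = k \<longleftrightarrow> i' = k'"
    "i' = 0 \<Longrightarrow> k \<le> i" "k' = 0 \<Longrightarrow> i \<le> k"
    using assms by linarith+
  ultimately show ?thesis using assms by (cases "i = 0"; cases "k = 0"; cases "i' = 0"; cases "k' = 0") auto
qed

lemma cycle_with_path_iso:
  fixes G :: "'a pair_pre_digraph"
  assumes G: "pair_graph G" and sp: "split_at (parcs G) (pverts G) A B c"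
    and path: "A = {c, x1, x2, x3}" "distinct [c, x1, x2, x3]"
      "(c, x1) \<in> parcs G" "(x1, x2) \<in> parcs G" "(x2, x3) \<in> parcs G"
      "(c, x2) \<notin> parcs G" "(c, x3) \<notin> parcs G" "(x1, x3) \<notin> parcs G"
    and w: "w 0 = c" "inj_on w {..<g}" "w ` {..<g} = B" "3 \<le> g"
      "\<And>i k. i < g \<Longrightarrow> k < g \<Longrightarrow> (w i, w k) \<in> parcs G \<longleftrightarrow> k = Suc i mod g \<or> i = Suc k mod g"
  shows "graph_isomorphic G (lollipop (g + 3) g)"
proof -
  interpret pair_graph G by (rule G)
  let ?E = "parcs G"
  have sym: "(x, y) \<in> ?E \<longleftrightarrow> (y, x) \<in> ?E" for x y using arcs_symmetric by blast
  have irr: "(x, x) \<notin> ?E" for x using no_loops' by blast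
  have L: "pair_wf_digraph (lollipop (g + 3) g)"
    using pair_graph_lollipop[of g "g + 3"] w(4)
    by (simp add: pair_graph_def pair_digraph_def pair_fin_digraph_def)
  have V: "pverts G = A \<union> B" and AB: "A \<inter> B = {c}"
    and no: "\<And>a b. a \<in> A - {c} \<Longrightarrow> b \<in> B - {c} \<Longrightarrow> (a, b) \<notin> ?E"
    using sp unfolding split_at_def by blast+
  have xB: "x1 \<notin> B" "x2 \<notin> B" "x3 \<notin> B" using AB path(1,2) by auto
  \<comment> \<open>The cycle is numbered backwards so that \<open>c = w 0\<close> gets the number
    \<open>g - 1\<close>, where the lollipop attaches its path. This map leads from numbers to
    vertices; the isomorphism is its inverse.\<close>
  define \<phi> where "\<phi> i = (if i < g then w (g - 1 - i) else if i = g then x1 else if i = g + 1 then x2 else x3)" for i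
  have \<phi>_low: "\<phi> i = w (g - 1 - i)" if "i < g" for i using that unfolding \<phi>_def by simp
  have \<phi>_high: "\<phi> g = x1" "\<phi> (g + 1) = x2" "\<phi> (g + 2) = x3" unfolding \<phi>_def by simp_all
  have ne: "x1 \<noteq> x2" "x1 \<noteq> x3" "x2 \<noteq> x3" using path(2) by auto
  have \<phi>_ge: "\<phi> k \<in> {x1, x2, x3} \<and> (\<phi> k = x1 \<longleftrightarrow> k = g)" if "g \<le> k" "k < g + 3" for k
  proof -
    have "k = g \<or> k = g + 1 \<or> k = g + 2" using that by arith
    then consider "k = g" | "k = g + 1" | "k = g + 2" by blast
    then show ?thesis
    proof cases
      case 1 then show ?thesis unfolding 1 \<phi>_high by simp
    next
      case 2 then show ?thesis unfolding 2 \<phi>_high using ne by simp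
    next
      case 3 then show ?thesis unfolding 3 \<phi>_high using ne by simp
    qed
  qed
  have \<phi>B: "\<phi> i \<in> B" if "i < g" for i using \<phi>_low[OF that] w(3,4) by auto
  have \<phi>c: "\<phi> i = c \<longleftrightarrow> i = g - 1" if "i < g" for i
    using inj_on_eq_iff[OF w(2), of "g - 1 - i" 0] \<phi>_low[OF that] w(1) that by auto
  have low: "\<phi> ` {..<g} = B"
  proof -
    have "(\<lambda>i. g - 1 - i) ` {..<g} = {..<g}"
    proof (intro equalityI subsetI)
      fix i assume "i \<in> {..<g}"
      then show "i \<in> (\<lambda>i. g - 1 - i) ` {..<g}" by (intro image_eqI[of _ _ "g - 1 - i"]) auto
    qed (use w(4) in auto)
    then have "B = w ` (\<lambda>i. g - 1 - i) ` {..<g}" using w(3) by simp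
    also have "\<dots> = \<phi> ` {..<g}" unfolding image_image using \<phi>_low by (intro image_cong) auto
    finally show ?thesis by simp
  qed
  have range: "{..<g + 3} = insert g (insert (g + 1) (insert (g + 2) {..<g}))" by auto
  have im: "\<phi> ` {..<g + 3} = pverts G"
    unfolding range image_insert low \<phi>_high V path(1) using AB by auto
  have "card (pverts G) = g + 3"
  proof -
    have "pverts G = insert x1 (insert x2 (insert x3 B))" unfolding V path(1) using AB by auto
    moreover have "card B = g" using card_image[OF w(2)] w(3) by simp
    moreover have "finite B" using w(3) by auto
    ultimately show ?thesis using xB path(2) by simp
  qed
  then have inj: "inj_on \<phi> {..<g + 3}" using im by (intro eq_card_imp_inj_on) auto
  have hl: "(\<phi> i, x) \<in> ?E \<longleftrightarrow> i = g - 1 \<and> x = x1" if "i < g" "x \<in> {x1, x2, x3}" for i x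
  proof (cases "i = g - 1")
    case True
    then show ?thesis using \<phi>c[OF that(1)] that(2) path by auto
  next
    case False
    then have "\<phi> i \<in> B - {c}" using \<phi>c[OF that(1)] \<phi>B[OF that(1)] by blast
    moreover have "x \<in> A - {c}" using that(2) path(1,2) by auto
    ultimately show ?thesis using no sym False by blast
  qed
  have adj: "(\<phi> i, \<phi> k) \<in> ?E \<longleftrightarrow> (i, k) \<in> parcs (lollipop (g + 3) g)" if "i < g + 3" "k < g + 3" for i k
  proof -
    consider "i < g" "k < g" | "i < g" "g \<le> k" | "g \<le> i" "k < g" | "g \<le> i" "g \<le> k" by linarith
    then show ?thesis
    proof cases
      case 1
      have "(\<phi> i, \<phi> k) \<in> ?E \<longleftrightarrow> g - 1 - k = Suc (g - 1 - i) mod g \<or> g - 1 - i = Suc (g - 1 - k) mod g"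
        unfolding \<phi>_low[OF 1(1)] \<phi>_low[OF 1(2)] by (rule w(5)) (use 1 in auto)
      also have "\<dots> \<longleftrightarrow> k = Suc i mod g \<or> i = Suc k mod g"
        by (rule reflect_adj) (use 1 in auto)
      also have "\<dots> \<longleftrightarrow> (i, k) \<in> parcs (lollipop (g + 3) g)"
      proof -
        have "\<not> (g - 1 \<le> i \<and> k = Suc i \<and> k < g + 3)" "\<not> (g - 1 \<le> k \<and> i = Suc k \<and> i < g + 3)"
          using 1 by linarith+
        then show ?thesis unfolding lollipop_adj[OF w(4)] using 1 by blast
      qed
      finally show ?thesis .
    next
      case 2
      have "\<phi> k \<in> {x1, x2, x3} \<and> (\<phi> k = x1 \<longleftrightarrow> k = g)" by (rule \<phi>_ge[OF 2(2) that(2)])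
      then have "(\<phi> i, \<phi> k) \<in> ?E \<longleftrightarrow> i = g - 1 \<and> k = g" using hl[OF 2(1)] by blast
      also have "\<dots> \<longleftrightarrow> (i, k) \<in> parcs (lollipop (g + 3) g)"
        unfolding lollipop_adj_high[OF w(4) 2(2)] using 2 that w(4) by linarith
      finally show ?thesis .
    next
      case 3
      have "\<phi> i \<in> {x1, x2, x3} \<and> (\<phi> i = x1 \<longleftrightarrow> i = g)" by (rule \<phi>_ge[OF 3(1) that(1)])
      then have "(\<phi> k, \<phi> i) \<in> ?E \<longleftrightarrow> k = g - 1 \<and> i = g" using hl[OF 3(2)] by blast
      also have "\<dots> \<longleftrightarrow> (k, i) \<in> parcs (lollipop (g + 3) g)"
        unfolding lollipop_adj_high[OF w(4) 3(1)] using 3 that w(4) by linarith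
      also have "\<dots> \<longleftrightarrow> (i, k) \<in> parcs (lollipop (g + 3) g)"
        unfolding lollipop_adj[OF w(4)] by blast
      finally show ?thesis using sym by blast
    next
      case 4
      obtain a b where e: "i = g + a" "k = g + b" using le_Suc_ex[OF 4(1)] le_Suc_ex[OF 4(2)] by blast
      then have "a < 3" "b < 3" using that by simp_all
      then have "a = 0 \<or> a = 1 \<or> a = 2" "b = 0 \<or> b = 1 \<or> b = 2" by arith+
      note ab = e this
      have "(\<phi> (g + a), \<phi> (g + b)) \<in> ?E \<longleftrightarrow> b = Suc a \<or> a = Suc b"
      proof -
        have E: "(x1, x2) \<in> ?E" "(x2, x1) \<in> ?E" "(x2, x3) \<in> ?E" "(x3, x2) \<in> ?E"
          "(x1, x3) \<notin> ?E" "(x3, x1) \<notin> ?E" using path(4,5,8) sym by blast+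
        have \<phi>': "\<phi> (g + 0) = x1" "\<phi> (g + 1) = x2" "\<phi> (g + 2) = x3" using \<phi>_high by simp_all
        from ab(3,4) show ?thesis
          by (elim disjE; hypsubst; unfold \<phi>'; simp add: E irr)
      qed
      also have "\<dots> \<longleftrightarrow> (i, k) \<in> parcs (lollipop (g + 3) g)"
        unfolding lollipop_adj_high[OF w(4) 4(2)] using ab by auto
      finally show ?thesis using ab by simp
    qed
  qed
  have bij: "bij_betw \<phi> {..<g + 3} (pverts G)" using inj im unfolding bij_betw_def by blast
  have pvL: "pverts (lollipop (g + 3) g) = {..<g + 3}" unfolding lollipop_def by simp
  have inv: "inv_into {..<g + 3} \<phi> x \<in> {..<g + 3}" "\<phi> (inv_into {..<g + 3} \<phi> x) = x" if "x \<in> pverts G" for x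
    using that im inv_into_into[of x \<phi> "{..<g + 3}"] f_inv_into_f[of x \<phi> "{..<g + 3}"] by auto
  show ?thesis
  proof (rule graph_isomorphicI[OF _ _ L])
    show "pair_wf_digraph G" by unfold_locales
    show "bij_betw (inv_into {..<g + 3} \<phi>) (pverts G) (pverts (lollipop (g + 3) g))"
      unfolding pvL by (rule bij_betw_inv_into[OF bij])
    fix x y assume "x \<in> pverts G" "y \<in> pverts G"
    then show "(inv_into {..<g + 3} \<phi> x, inv_into {..<g + 3} \<phi> y) \<in> parcs (lollipop (g + 3) g)
      \<longleftrightarrow> (x, y) \<in> ?E"
      using adj[of "inv_into {..<g + 3} \<phi> x" "inv_into {..<g + 3} \<phi> y"] inv by simp
  qed
qed

section \<open>The Wiener index of a pair graph\<close>


text \<open>Needed for vertex deletion, where the arc sets agree only inside the remaining vertex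
  set.\<close>

lemma conn_cong:
  assumes "\<And>x y. x \<in> W \<Longrightarrow> y \<in> W \<Longrightarrow> (x, y) \<in> E \<longleftrightarrow> (x, y) \<in> E'"
  shows "conn E W \<longleftrightarrow> conn E' W"
proof -
  have "conn P W" if "conn Q W" "\<And>x y. x \<in> W \<Longrightarrow> y \<in> W \<Longrightarrow> (x, y) \<in> Q \<longleftrightarrow> (x, y) \<in> P" for P Q :: "'a rel"
  proof (rule connI)
    show "W \<noteq> {}" using that(1) unfolding conn_def by blast
    fix S assume S: "S \<subseteq> W" "S \<noteq> {}" "\<And>x y. x \<in> S \<Longrightarrow> y \<in> W \<Longrightarrow> (x, y) \<in> P \<Longrightarrow> y \<in> S"
    have "S = W" by (rule connD[OF that(1) S(1,2)]) (use S(1,3) that(2) in blast)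
    then show "W \<subseteq> S" by simp
  qed
  then show ?thesis using assms by blast
qed

text \<open>The vertices reachable from \<open>u\<close> form a closed set; conversely a closed set
  contains whatever its elements reach.\<close>

lemma conn_iff_rtrancl_on:
  "conn E U \<longleftrightarrow> U \<noteq> {} \<and> (\<forall>u\<in>U. \<forall>v\<in>U. (u, v) \<in> rtrancl_on U E)"
proof
  assume conn: "conn E U"
  have "{v \<in> U. (u, v) \<in> rtrancl_on U E} = U" if "u \<in> U" for u
  proof (rule connD[OF conn])
    show "{v \<in> U. (u, v) \<in> rtrancl_on U E} \<noteq> {}" using that by blast
  qed (auto intro: rtrancl_on_into_rtrancl_on)
  then show "U \<noteq> {} \<and> (\<forall>u\<in>U. \<forall>v\<in>U. (u, v) \<in> rtrancl_on U E)"
    using conn unfolding conn_def by blast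
next
  assume r: "U \<noteq> {} \<and> (\<forall>u\<in>U. \<forall>v\<in>U. (u, v) \<in> rtrancl_on U E)"
  show "conn E U"
  proof (rule connI)
    fix S assume S: "S \<subseteq> U" "S \<noteq> {}" "\<And>x y. x \<in> S \<Longrightarrow> y \<in> U \<Longrightarrow> (x, y) \<in> E \<Longrightarrow> y \<in> S"
    then obtain x where x: "x \<in> S" by blast
    show "U \<subseteq> S"
    proof
      fix y assume "y \<in> U"
      then have "(x, y) \<in> rtrancl_on U E" using r S(1) x by blast
      then show "y \<in> S"
        by (induction rule: rtrancl_on_induct) (use x S(3) in auto)
    qed
  qed (use r in blast)
qed

lemma connected_iff_conn:
  "connected H \<longleftrightarrow> conn (parcs (mk_symmetric H)) (verts H)"
  unfolding connected_def strongly_connected_def conn_iff_rtrancl_on reachable_def by simp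

lemma ugraph_parcs: "pair_graph G \<Longrightarrow> ugraph (parcs G)"
proof -
  assume "pair_graph G"
  then interpret pair_graph G .
  show ?thesis by unfold_locales (use arcs_symmetric no_loops' in blast)+
qed

lemma pair_graph_connected_iff:
  assumes "pair_graph G"
  shows "connected (with_proj G) \<longleftrightarrow> conn (parcs G) (pverts G)"
proof -
  interpret pair_graph G by fact
  have "parcs (mk_symmetric (with_proj G)) = parcs G"
    unfolding parcs_mk_symmetric using arcs_symmetric by force
  then show ?thesis unfolding connected_iff_conn by simp
qed

lemma pair_graph_cut_vertex_iff:
  assumes "pair_graph G"
  shows "cut_vertex G v \<longleftrightarrow> is_cut (parcs G) (pverts G) v"
proof -
  interpret pair_graph G by fact
  let ?H = "pre_digraph.del_vert (with_proj G) v"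
  have "(x, y) \<in> parcs (mk_symmetric ?H) \<longleftrightarrow> (x, y) \<in> parcs G"
    if "x \<in> pverts G - {v}" "y \<in> pverts G - {v}" for x y
    using that arcs_symmetric unfolding parcs_mk_symmetric pre_digraph.del_vert_def by force
  then have "conn (parcs (mk_symmetric ?H)) (pverts G - {v}) \<longleftrightarrow> conn (parcs G) (pverts G - {v})"
    by (rule conn_cong)
  moreover have "verts ?H = pverts G - {v}" by (simp add: pre_digraph.del_vert_def)
  ultimately have "connected ?H \<longleftrightarrow> conn (parcs G) (pverts G - {v})"
    unfolding connected_iff_conn by simp
  then show ?thesis unfolding cut_vertex_def is_cut_def by blast
qed

lemma graph_dist_eq_sdist:
  assumes "pair_graph G" "conn (parcs G) (pverts G)" "u \<in> pverts G" "v \<in> pverts G"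
  shows "graph_dist G u v = sdist (parcs G) (pverts G) u v"
proof -
  interpret pair_graph G by fact
  interpret U: ugraph "parcs G" by (rule ugraph_parcs[OF assms(1)])
  let ?d = "sdist (parcs G) (pverts G)"
  \<comment> \<open>Paths are built backwards from their end \<open>v\<close>. The bound on the
    distances of their vertices ensures that a new first vertex, at distance \<open>Suc k\<close>,
    is not a repetition.\<close>
  have ex: "\<exists>p. apath x p v \<and> length p = k \<and> (\<forall>y\<in>set (pawalk_verts x p). ?d v y \<le> k)"
    if "x \<in> pverts G" "?d v x = k" for x k
    using that
  proof (induction k arbitrary: x)
    case 0
    then have "x = v" using U.sdist_eq_0_iff[OF assms(2,4)] by blast
    then show ?case using assms(4) by (intro exI[of _ "[]"]) (simp add: apath_Nil_iff)
  next
    case (Suc k)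
    then have "x \<noteq> v" by auto
    then obtain y where y: "y \<in> pverts G" "(y, x) \<in> parcs G" "?d v x = Suc (?d v y)"
      using U.descending_sdist[OF assms(2,4)] Suc.prems unfolding descending_def by blast
    then obtain p where p: "apath y p v" "length p = k" "\<forall>z\<in>set (pawalk_verts y p). ?d v z \<le> k"
      using Suc.IH[of y] Suc.prems by auto
    have "x \<notin> set (pawalk_verts y p)" using p(3) Suc.prems by force
    then have "apath x ((x, y) # p) v" using p(1) y(2) arcs_symmetric by (simp add: apath_Cons_iff)
    then show ?case using p Suc.prems by (intro exI[of _ "(x, y) # p"]) force
  qed
  have walk: "(x, v) \<in> (Restr (parcs G) (pverts G)) ^^ length p" if "awalk x p v" for x p
    using that
  proof (induction p arbitrary: x)
    case (Cons e p)
    then have e: "(x, snd e) \<in> Restr (parcs G) (pverts G)" "awalk (snd e) p v"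
      using in_arcsD1 in_arcsD2 by (cases e; auto simp: awalk_Cons_iff)+
    have "(x, v) \<in> (Restr (parcs G) (pverts G)) ^^ Suc (length p)"
      by (rule relpow_Suc_I2[OF e(1) Cons.IH[OF e(2)]])
    then show ?case by simp
  qed (simp add: awalk_Nil_iff)
  show ?thesis
    unfolding graph_dist_def
  proof (rule Least_equality)
    show "\<exists>p. apath u p v \<and> length p = ?d u v"
      using ex[OF assms(3) refl] U.sdist_sym[of "pverts G" v u] by auto
    fix k assume "\<exists>p. apath u p v \<and> length p = k"
    then obtain p where "apath u p v" "length p = k" by blast
    then have "(u, v) \<in> (Restr (parcs G) (pverts G)) ^^ k" using walk unfolding apath_def by blast
    then show "?d u v \<le> k" by (rule U.sdist_le)
  qed
qed

text \<open>Ordered pairs of distinct vertices are grouped by their underlying set; each group is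
  \<open>{(a, b), (b, a)}\<close> and contributes the same distance twice.\<close>

lemma two_wiener_index:
  assumes "pair_graph G" "conn (parcs G) (pverts G)"
  shows "2 * wiener_index G = wiener2 (parcs G) (pverts G)"
proof -
  interpret pair_graph G by fact
  interpret U: ugraph "parcs G" by (rule ugraph_parcs[OF assms(1)])
  let ?U = "pverts G" and ?d = "sdist (parcs G) (pverts G)"
  let ?P = "{e. e \<subseteq> ?U \<and> card e = 2}" and ?D = "{(v, u) \<in> ?U \<times> ?U. v \<noteq> u}"
  have fin: "finite ?U" by (rule pair_finite_verts)
  have finP: "finite ?P" by (rule finite_subset[of _ "Pow ?U"]) (use fin in auto)
  have finD: "finite ?D" by (rule finite_subset[of _ "?U \<times> ?U"]) (use fin in auto)
  have "wiener2 (parcs G) ?U = (\<Sum>(v, u)\<in>?U \<times> ?U. ?d v u)"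
    unfolding wiener2_def transmission_def by (rule sum.cartesian_product)
  also have "\<dots> = (\<Sum>(v, u)\<in>?D. ?d v u)"
    by (rule sum.mono_neutral_right) (use fin in auto)
  also have "\<dots> = (\<Sum>e\<in>?P. \<Sum>(v, u)\<in>{x \<in> ?D. (case x of (v, u) \<Rightarrow> {v, u}) = e}. ?d v u)"
    by (rule sum.group[symmetric]) (use finD finP in auto)
  also have "\<dots> = (\<Sum>e\<in>?P. 2 * (THE d. \<exists>u v. e = {u, v} \<and> d = graph_dist G u v))"
  proof (rule sum.cong[OF refl])
    fix e assume "e \<in> ?P"
    then obtain a b where e: "e = {a, b}" "a \<noteq> b" "a \<in> ?U" "b \<in> ?U" by (auto simp: card_2_iff)
    have "(THE d. \<exists>u v. e = {u, v} \<and> d = graph_dist G u v) = graph_dist G a b"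
    proof (rule the_equality)
      fix d assume "\<exists>u v. e = {u, v} \<and> d = graph_dist G u v"
      then obtain u v where "{a, b} = {u, v}" "d = graph_dist G u v" using e(1) by blast
      then show "d = graph_dist G a b" using graph_dist_sym[OF assms(1), of a b] by (auto simp: doubleton_eq_iff)
    qed (use e in blast)
    moreover have "{x \<in> ?D. (case x of (v, u) \<Rightarrow> {v, u}) = e} = {(a, b), (b, a)}"
      using e by (auto simp: doubleton_eq_iff)
    ultimately show "(\<Sum>(v, u)\<in>{x \<in> ?D. (case x of (v, u) \<Rightarrow> {v, u}) = e}. ?d v u)
        = 2 * (THE d. \<exists>u v. e = {u, v} \<and> d = graph_dist G u v)"
      using e(2) graph_dist_eq_sdist[OF assms e(3,4)] U.sdist_sym[of ?U a b] by simp
  qed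
  also have "\<dots> = 2 * wiener_index G" unfolding wiener_index_def by (rule sum_distrib_left[symmetric])
  finally show ?thesis by simp
qed

text \<open>The distance between images in \<open>H\<close> is \<open>lip\<close> and
  \<open>descending\<close> on \<open>G\<close>, hence it is the distance in
  \<open>G\<close>.\<close>

lemma graph_isomorphic_wiener2:
  assumes "graph_isomorphic G H" "ugraph (parcs G)" "ugraph (parcs H)"
    "conn (parcs G) (pverts G)" "conn (parcs H) (pverts H)"
  shows "wiener2 (parcs G) (pverts G) = wiener2 (parcs H) (pverts H)"
proof -
  interpret G: ugraph "parcs G" by fact
  interpret H: ugraph "parcs H" by fact
  obtain f where f: "bij_betw f (pverts G) (pverts H)"
    and adj: "\<And>x y. x \<in> pverts G \<Longrightarrow> y \<in> pverts G \<Longrightarrow> (f x, f y) \<in> parcs H \<longleftrightarrow> (x, y) \<in> parcs G"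
    using graph_isomorphicE[OF assms(1)] by metis
  have fU: "f x \<in> pverts H" if "x \<in> pverts G" for x using bij_betwE[OF f] that by blast
  have d: "sdist (parcs G) (pverts G) v x = sdist (parcs H) (pverts H) (f v) (f x)"
    if v: "v \<in> pverts G" and x: "x \<in> pverts G" for v x
  proof (rule G.sdist_eqI[OF assms(4) v _ _ _ x, of "\<lambda>x. sdist (parcs H) (pverts H) (f v) (f x)"])
    show "lip (parcs G) (pverts G) (\<lambda>x. sdist (parcs H) (pverts H) (f v) (f x))"
      using H.lip_sdist[OF assms(5) fU[OF v]] fU adj unfolding lip_def by blast
    show "descending (parcs G) (pverts G) v (\<lambda>x. sdist (parcs H) (pverts H) (f v) (f x))"
      unfolding descending_def
    proof (intro ballI impI)
      fix x assume x: "x \<in> pverts G" "x \<noteq> v"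
      then have "f x \<noteq> f v" using f v unfolding bij_betw_def by (auto dest: inj_onD)
      then obtain y where y: "y \<in> pverts H" "(y, f x) \<in> parcs H"
          "sdist (parcs H) (pverts H) (f v) (f x) = Suc (sdist (parcs H) (pverts H) (f v) y)"
        using H.descending_sdist[OF assms(5) fU[OF v]] fU[OF x(1)] unfolding descending_def by blast
      obtain z where "z \<in> pverts G" "y = f z" using y(1) f unfolding bij_betw_def by blast
      then show "\<exists>y\<in>pverts G. (y, x) \<in> parcs G \<and>
          sdist (parcs H) (pverts H) (f v) (f x) = Suc (sdist (parcs H) (pverts H) (f v) (f y))"
        using y adj x(1) by blast
    qed
  qed simp
  have "wiener2 (parcs H) (pverts H)
      = (\<Sum>v\<in>pverts G. \<Sum>x\<in>pverts G. sdist (parcs H) (pverts H) (f v) (f x))"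
    unfolding wiener2_def transmission_def sum.reindex_bij_betw[OF f, symmetric] ..
  also have "\<dots> = wiener2 (parcs G) (pverts G)"
    unfolding wiener2_def transmission_def using d by (intro sum.cong refl) simp
  finally show ?thesis ..
qed

section \<open>Lower bound for the Wiener index of the lollipop\<close>

lemma sum_min: "(\<Sum>k<g. min k (g - k)) = qsq g"
proof (induction g rule: induct_nat_012)
  case (ge2 g)
  have "(\<Sum>k<Suc (Suc g). min k (Suc (Suc g) - k)) = (\<Sum>k<Suc g. min (Suc k) (Suc (Suc g) - Suc k))"
    by (subst sum.lessThan_Suc_shift) simp
  also have "\<dots> = (\<Sum>k<Suc g. 1 + min k (g - k))" by (intro sum.cong) auto
  also have "\<dots> = Suc g + (\<Sum>k<g. min k (g - k))" by (simp only: sum.distrib) simp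
  finally show ?case using ge2(1) qsq_Suc_Suc by simp
qed simp_all

text \<open>Distance on the cycle \<open>C\<^sub>g\<close>; the sum of the two truncated differences
  is the absolute difference.\<close>

definition cyc_dist :: "nat \<Rightarrow> nat \<Rightarrow> nat \<Rightarrow> nat" where
  "cyc_dist g a b = min ((a - b) + (b - a)) (g - ((a - b) + (b - a)))"

text \<open>By rotation the row of \<open>a\<close> is the row of 0 rearranged: the positions before
  \<open>a\<close> become the distances along the cycle from \<open>g - a\<close> on.\<close>

lemma sum_cyc_dist:
  assumes "a < g"
  shows "(\<Sum>b<g. cyc_dist g a b) = qsq g"
proof -
  let ?m = "\<lambda>k. min k (g - k)"
  have "(\<Sum>b<g. cyc_dist g a b) = (\<Sum>b<a. cyc_dist g a b) + (\<Sum>b=a..<g. cyc_dist g a b)"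
    using assms by (simp add: atLeast0LessThan[symmetric] sum.atLeastLessThan_concat)
  also have "(\<Sum>b<a. cyc_dist g a b) = (\<Sum>k=g-a..<g. ?m k)"
    by (rule sum.reindex_bij_witness[of _ "\<lambda>k. k + a - g" "\<lambda>b. b + g - a"])
      (use assms in \<open>auto simp: cyc_dist_def min_def\<close>)
  also have "(\<Sum>b=a..<g. cyc_dist g a b) = (\<Sum>k<g-a. ?m k)"
    by (rule sum.reindex_bij_witness[of _ "\<lambda>k. k + a" "\<lambda>b. b - a"])
      (use assms in \<open>auto simp: cyc_dist_def\<close>)
  also have "(\<Sum>k=g-a..<g. ?m k) + (\<Sum>k<g-a. ?m k) = (\<Sum>k<g. ?m k)"
    using sum.atLeastLessThan_concat[of 0 "g - a" g ?m] assms by (simp add: atLeast0LessThan add.commute)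
  finally show ?thesis using sum_min by simp
qed

text \<open>A lollipop projects onto its cycle and onto its path; the sum of the two projected distances
  changes by at most one along every edge.\<close>

definition lol_dist :: "nat \<Rightarrow> nat \<Rightarrow> nat \<Rightarrow> nat" where
  "lol_dist g i j = cyc_dist g (min i (g - 1)) (min j (g - 1)) 
    + ((i - (g - 1)) - (j - (g - 1)) + ((j - (g - 1)) - (i - (g - 1))))"

lemma cyc_dist_self [simp]: "cyc_dist g a a = 0"
  by (simp add: cyc_dist_def)

lemma cyc_dist_sym: "cyc_dist g a b = cyc_dist g b a"
  unfolding cyc_dist_def by (simp add: add.commute)

lemma cyc_dist_add: "cyc_dist g a (a + d) = min d (g - d)" "cyc_dist g (a + d) a = min d (g - d)"
  unfolding cyc_dist_def by simp_all

lemma min_step: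
  fixes d g :: nat
  shows "min (Suc d) (g - Suc d) \<le> Suc (min d (g - d))" "min d (g - d) \<le> Suc (min (Suc d) (g - Suc d))"
  unfolding min_def by auto

lemma cyc_dist_step:
  assumes "a < g" "b < g"
  shows "cyc_dist g a (Suc b mod g) \<le> Suc (cyc_dist g a b) \<and> cyc_dist g a b \<le> Suc (cyc_dist g a (Suc b mod g))"
proof (cases "Suc b = g")
  case True
  then have "a \<le> b" using assms by simp
  then obtain d where d: "b = a + d" using le_Suc_ex by blast
  have "cyc_dist g a b = min d (Suc a)" "cyc_dist g a 0 = min a (Suc d)"
    using cyc_dist_add(1)[of g a d] cyc_dist_add(2)[of g 0 a] True d by auto
  then show ?thesis using True by (simp add: min_def)
next
  case False
  then have m: "Suc b mod g = Suc b" using assms by simp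
  show ?thesis
  proof (cases "a \<le> b")
    case True
    then obtain d where d: "b = a + d" using le_Suc_ex by blast
    show ?thesis
      unfolding m using cyc_dist_add(1)[of g a d] cyc_dist_add(1)[of g a "Suc d"] min_step[of d g] d by simp
  next
    case False
    then obtain d where d: "a = Suc b + d" using le_Suc_ex[of "Suc b" a] by auto
    show ?thesis
      unfolding m
      using cyc_dist_add(2)[of g "Suc b" d] cyc_dist_add(2)[of g b "Suc d"] min_step[of d g] d by simp
  qed
qed

lemma diff_step:
  fixes p q :: nat
  shows "(p - Suc q) + (Suc q - p) \<le> Suc ((p - q) + (q - p))" "(p - q) + (q - p) \<le> Suc ((p - Suc q) + (Suc q - p))"
  by arith+

lemma lip_lol_dist:
  assumes "3 \<le> g" "i < g + 3"
  shows "lip (parcs (lollipop (g + 3) g)) {..<g + 3} (lol_dist g i)"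
  unfolding lip_def
proof (intro ballI impI)
  fix x y assume "(x, y) \<in> parcs (lollipop (g + 3) g)"
  then consider "x < g" "y = Suc x mod g" | "y < g" "x = Suc y mod g" | "g - 1 \<le> x" "y = Suc x" | "g - 1 \<le> y" "x = Suc y"
    unfolding lollipop_adj[OF assms(1)] by blast
  then show "lol_dist g i y \<le> Suc (lol_dist g i x)"
  proof cases
    case 1
    have "y < g" using 1 assms by simp
    then have e: "min x (g - 1) = x" "min y (g - 1) = y" "x - (g - 1) = 0" "y - (g - 1) = 0" using 1(1) by auto
    show ?thesis
      unfolding lol_dist_def e using cyc_dist_step[of "min i (g - 1)" g x] 1 assms by simp
  next
    case 2
    have "x < g" using 2 assms by simp
    then have e: "min x (g - 1) = x" "min y (g - 1) = y" "x - (g - 1) = 0" "y - (g - 1) = 0" using 2(1) by auto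
    show ?thesis
      unfolding lol_dist_def e using cyc_dist_step[of "min i (g - 1)" g y] 2 assms by simp
  next
    case 3
    then have e: "min x (g - 1) = g - 1" "min y (g - 1) = g - 1" "y - (g - 1) = Suc (x - (g - 1))" by auto
    show ?thesis unfolding lol_dist_def e using diff_step(1)[of "i - (g - 1)" "x - (g - 1)"] by linarith
  next
    case 4
    then have e: "min x (g - 1) = g - 1" "min y (g - 1) = g - 1" "x - (g - 1) = Suc (y - (g - 1))" by auto
    show ?thesis unfolding lol_dist_def e using diff_step(2)[of "i - (g - 1)" "y - (g - 1)"] by linarith
  qed
qed

text \<open>The total consists of \<open>g * qsq g\<close> inside the cycle,
  \<open>2 * (3 * qsq g + 6 * g)\<close> between the cycle and the three other path vertices, and 8
  among these three.\<close>

lemma sum_lol_dist: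
  assumes "3 \<le> g"
  shows "(\<Sum>i<g+3. \<Sum>j<g+3. lol_dist g i j) = wbound3 (g + 3)"
proof -
  have top: "(\<Sum>j<g+3. h j) = (\<Sum>j<g. h j) + h g + h (g + 1) + h (g + 2)" for h :: "nat \<Rightarrow> nat"
    by (simp add: numeral_3_eq_3)
  have low: "lol_dist g i j = cyc_dist g i j" if "i < g" "j < g" for i j
  proof -
    have "min i (g - 1) = i" "min j (g - 1) = j" "i - (g - 1) = 0" "j - (g - 1) = 0" using that by auto
    then show ?thesis unfolding lol_dist_def by simp
  qed
  have mix: "lol_dist g i (g + a) = cyc_dist g (g - 1) i + Suc a" "lol_dist g (g + a) i = cyc_dist g (g - 1) i + Suc a"
    if "i < g" for i a
  proof -
    have e: "min i (g - 1) = i" "min (g + a) (g - 1) = g - 1" "i - (g - 1) = 0" "g + a - (g - 1) = Suc a"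
      using that by auto
    show "lol_dist g i (g + a) = cyc_dist g (g - 1) i + Suc a" "lol_dist g (g + a) i = cyc_dist g (g - 1) i + Suc a"
      unfolding lol_dist_def e using cyc_dist_sym[of g "g - 1" i] by simp_all
  qed
  have high: "lol_dist g (g + a) (g + b) = (a - b) + (b - a)" for a b
  proof -
    have e: "min (g + a) (g - 1) = g - 1" "min (g + b) (g - 1) = g - 1"
      "g + a - (g - 1) = Suc a" "g + b - (g - 1) = Suc b" using assms by auto
    show ?thesis unfolding lol_dist_def e by simp
  qed
  have row: "(\<Sum>j<g. cyc_dist g (g - 1) j + Suc a) = qsq g + g * Suc a" for a
    using sum_cyc_dist[of "g - 1" g] assms by (simp only: sum.distrib) simp
  \<comment> \<open>The 6 is 1 + 2 + 3, the depths of the three path vertices below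
    \<open>g - 1\<close>.\<close>
  have rl: "(\<Sum>j<g+3. lol_dist g i j) = qsq g + 3 * cyc_dist g (g - 1) i + 6" if "i < g" for i
  proof -
    have "(\<Sum>j<g. lol_dist g i j) = qsq g" using low[OF that] sum_cyc_dist[OF that] by simp
    then show ?thesis unfolding top using mix(1)[OF that, of 0] mix(1)[OF that, of 1] mix(1)[OF that, of 2] by simp
  qed
  have rh: "(\<Sum>j<g+3. lol_dist g (g + a) j)
      = qsq g + g * Suc a + a + ((a - 1) + (1 - a)) + ((a - 2) + (2 - a))" for a
  proof -
    have "(\<Sum>j<g. lol_dist g (g + a) j) = qsq g + g * Suc a" using mix(2) row[of a] by simp
    then show ?thesis unfolding top using high[of a 0] high[of a 1] high[of a 2] by simp
  qed
  have "(\<Sum>i<g. \<Sum>j<g+3. lol_dist g i j) = (\<Sum>i<g. qsq g + 3 * cyc_dist g (g - 1) i + 6)"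
    using rl by (intro sum.cong) auto
  also have "\<dots> = g * qsq g + 3 * qsq g + 6 * g"
    using sum_cyc_dist[of "g - 1" g] assms by (simp add: sum.distrib flip: sum_distrib_left)
  finally show ?thesis
    unfolding top[of "\<lambda>i. \<Sum>j<g+3. lol_dist g i j"] wbound3_def
    using rh[of 0] rh[of 1] rh[of 2] by (simp add: algebra_simps)
qed

lemma conn_lollipop:
  assumes "3 \<le> g"
  shows "conn (parcs (lollipop (g + 3) g)) {..<g + 3}"
proof (rule connI)
  fix S assume S: "S \<subseteq> {..<g + 3}" "S \<noteq> {}"
    "\<And>x y. x \<in> S \<Longrightarrow> y \<in> {..<g + 3} \<Longrightarrow> (x, y) \<in> parcs (lollipop (g + 3) g) \<Longrightarrow> y \<in> S"
  have edge: "(i, Suc i) \<in> parcs (lollipop (g + 3) g) \<and> (Suc i, i) \<in> parcs (lollipop (g + 3) g)"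
    if "Suc i < g + 3" for i
    unfolding lollipop_adj[OF assms] using that by (cases "Suc i < g") auto
  obtain x where x: "x \<in> S" using S(2) by blast
  \<comment> \<open>A descent along consecutive numbers; truncated subtraction makes it stop at
    0.\<close>
  have "x - k \<in> S" for k
  proof (induction k)
    case (Suc k)
    show ?case
    proof (cases "x - k")
      case (Suc m)
      then have "Suc m < g + 3" using \<open>x - k \<in> S\<close> S(1) by auto
      then have "m \<in> S" using S(3)[of "Suc m" m] edge[of m] Suc \<open>x - k \<in> S\<close> by auto
      moreover have "x - Suc k = m" using Suc by simp
      ultimately show ?thesis by simp
    qed (use Suc in simp)
  qed (use x in simp)
  from this[of x] have 0: "0 \<in> S" by simp
  have "i < g + 3 \<longrightarrow> i \<in> S" for i
  proof (induction i)
    case (Suc i)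
    then show ?case using S(3)[of i "Suc i"] edge[of i] by auto
  qed (use 0 in simp)
  then show "{..<g + 3} \<subseteq> S" by blast
next
  have "0 \<in> {..<g + 3}" by simp
  then show "{..<g + 3} \<noteq> {}" by blast
qed

text \<open>A \<open>lip\<close> function that is 0 at the root stays below the distance, and this
  is the direction that the comparison with \<open>G\<close> requires.\<close>

lemma wiener2_lollipop_ge:
  assumes "3 \<le> g"
  shows "wbound3 (g + 3) \<le> wiener2 (parcs (lollipop (g + 3) g)) {..<g + 3}"
proof -
  interpret ugraph "parcs (lollipop (g + 3) g)"
    by (rule ugraph_parcs, rule pair_graph_lollipop) (use assms in auto)
  have "lol_dist g i j \<le> sdist (parcs (lollipop (g + 3) g)) {..<g + 3} i j" if "i < g + 3" "j < g + 3" for i j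
    by (rule sdist_geI[OF conn_lollipop[OF assms] _ lip_lol_dist[OF assms that(1)]])
      (use that in \<open>auto simp: lol_dist_def\<close>)
  then show ?thesis
    unfolding sum_lol_dist[OF assms, symmetric] wiener2_def transmission_def by (intro sum_mono) auto
qed

theorem theorem5p9:
  fixes G :: "'a pair_pre_digraph" and n :: nat
  assumes "n \<ge> 14"
    and "G \<in> connected_cut_graphs n 3"
  shows "wiener_index G \<le> wiener_index (lollipop n (n - 3)) \<and>
    (wiener_index G = wiener_index (lollipop n (n - 3)) \<longleftrightarrow>
      graph_isomorphic G (lollipop n (n - 3)))"
proof -
  define g where "g = n - 3"
  have n: "n = g + 3" and g: "11 \<le> g" "3 \<le> g" using assms(1) unfolding g_def by auto
  let ?L = "lollipop (g + 3) g"
  let ?E = "parcs G" and ?V = "pverts G"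
  have G: "pair_graph G" and "connected (with_proj G)" and V: "card ?V = g + 3"
    and "card {v. cut_vertex G v} = 3"
    using assms(2) unfolding connected_cut_graphs_def n by auto
  then have conn: "conn ?E ?V" and cuts: "card {v. is_cut ?E ?V v} = 3"
    using pair_graph_connected_iff[OF G] pair_graph_cut_vertex_iff[OF G] by auto
  interpret G: pair_graph G by (rule G)
  interpret U: ugraph ?E by (rule ugraph_parcs[OF G])
  have fin: "finite ?V" by (rule G.pair_finite_verts)
  have L: "pair_graph ?L" by (rule pair_graph_lollipop) (use g in auto)
  have pvL: "pverts ?L = {..<g + 3}" by (simp add: lollipop_def)
  have connL: "conn (parcs ?L) (pverts ?L)" unfolding pvL by (rule conn_lollipop[OF g(2)])
  have geL: "wbound3 (g + 3) \<le> wiener2 (parcs ?L) (pverts ?L)"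
    unfolding pvL by (rule wiener2_lollipop_ge[OF g(2)])
  have le: "wiener2 ?E ?V \<le> wbound3 (g + 3)"
  proof -
    have "2 \<le> card ?V" using V by simp
    then obtain r where r: "r \<in> ?V" "\<not> is_cut ?E ?V r" using U.exists_not_cut[OF fin conn] by blast
    have "14 \<le> card ?V" using V g by simp
    then show ?thesis using U.wiener2_le_3_split[OF fin conn cuts _ r] unfolding V by metis
  qed
  have W: "2 * wiener_index G = wiener2 ?E ?V" "2 * wiener_index ?L = wiener2 (parcs ?L) (pverts ?L)"
    by (rule two_wiener_index[OF G conn], rule two_wiener_index[OF L connL])
  have iso: "graph_isomorphic G ?L" if "wiener_index G = wiener_index ?L"
  proof -
    \<comment> \<open>The bound lies between the two Wiener indices, so their equality puts
      \<open>G\<close> on the bound.\<close>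
    have eq: "wiener2 ?E ?V = wbound3 (card ?V)" using that W le geL unfolding V by linarith
    have "14 \<le> card ?V" using V g by simp
    from U.extremal_structure[OF fin conn cuts this eq] obtain c A B where
      sp: "split_at ?E ?V A B c" and A: "conn ?E A" "finite A" "card {x. is_cut ?E A x} = 2" "card A = 4"
        "transmission ?E A c = 6"
      and B: "conn ?E B" "finite B" "{x. is_cut ?E B x} = {}" "wiener2 ?E B = card B * qsq (card B)" by metis
    have c: "c \<in> A" "c \<in> B" using sp unfolding split_at_def by blast+
    have cB: "card B = g" using U.split_at_card[OF sp fin] A(4) V by simp
    obtain x1 x2 x3 where path: "A = {c, x1, x2, x3}" "distinct [c, x1, x2, x3]"
      "(c, x1) \<in> ?E" "(x1, x2) \<in> ?E" "(x2, x3) \<in> ?E" "(c, x2) \<notin> ?E" "(c, x3) \<notin> ?E" "(x1, x3) \<notin> ?E"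
      using U.four_path[OF A(2,1) c(1) A(3-5)] by metis
    have "card {u \<in> B. (v, u) \<in> ?E} = 2" if "v \<in> B" for v
      by (rule U.extremal_two_regular[OF B(2,1,3,4) _ that]) (use cB g in simp)
    from U.two_regular_cycle[OF B(2,1) this c(2)] obtain w where w: "w 0 = c" "inj_on w {..<g}" "w ` {..<g} = B"
      "\<And>i k. i < g \<Longrightarrow> k < g \<Longrightarrow> (w i, w k) \<in> ?E \<longleftrightarrow> k = Suc i mod g \<or> i = Suc k mod g"
      unfolding cB by metis
    show ?thesis by (rule cycle_with_path_iso[OF G sp path w(1-3) g(2) w(4)])
  qed
  have "wiener_index G = wiener_index ?L" if "graph_isomorphic G ?L"
    using graph_isomorphic_wiener2[OF that ugraph_parcs[OF G] ugraph_parcs[OF L] conn connL] W by simp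
  moreover have "wiener_index G \<le> wiener_index ?L" using W le geL by linarith
  moreover have "lollipop n (n - 3) = ?L" unfolding n by simp
  ultimately show ?thesis using iso by metis
qed

end
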